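(* Let $Y$ be a real random variable with Lebesgue density $f : \mathbb{R} \to [0,\infty)$, and let $G(x) := \mathbb{P}(U \le x)$, $0 \le x \le 1$, be the c.d.f. of $U := Y - \lfloor Y \rfloor$. Let $k \ge 1$ be an integer, and suppose that $f$ is $k$ times absolutely continuous such that $\mathrm{TV}(f^{(k)}) < \infty$ for some version of $f^{(k)}$. Then for $0 \le x < y \le 1$, $$\bigl| G(y) - G(x) - (y-x) \bigr| \le (y-x)\bigl(1-(y-x)\bigr) \frac{\mathrm{TV}(f^{(k)})}{2 \cdot 6^k} .$$ In particular, $$\mathrm{KD}(G) \le \frac{\mathrm{TV}(f^{(k)})}{8 \cdot 6^k} \quad\text{and}\quad \mathrm{MRAE}(G) \le \frac{\mathrm{TV}(f^{(k)})}{2 \cdot 6^k} .$$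
   Context: For a function $h : \mathbb{R} \to \mathbb{R}$, the total variation is $$\mathrm{TV}(h) := \sup\Bigl\{ \sum_{i=1}^m |h(t_i) - h(t_{i-1})| : m \in \mathbb{N};\ t_0 < t_1 < \cdots < t_m \text{ in } \mathbb{R} \Bigr\}.$$ A function $h$ on the real line is called $k \ge 1$ times absolutely continuous if $h \in \mathcal{C}^{k-1}(\mathbb{R})$ and its derivative $h^{(k-1)}$ is (locally) absolutely continuous; $h^{(k)}$ then denotes some version of the derivative of $h^{(k-1)}$ in $L^1_{\rm loc}(\mathbb{R})$ (i.e. a function $\mathbb{R}\to\mathbb{R}$ equal almost everywhere to that derivative). In the claim, $\mathrm{TV}(f^{(k)})$ is the total variation of the version of $f^{(k)}$ that is assumed to have finite total variation. The Kuiper distance between the distribution of $U$ and the uniform distribution on $[0,1)$ is $\mathrm{KD}(G) := \sup_{0 \le x < y \le 1} |G(y) - G(x) - (y-x)|$, and the maximal relative approximation error is $\mathrm{MRAE}(G) := \sup_{0 \le x < y \le 1} \bigl| \frac{G(y)-G(x)}{y-x} - 1 \bigr|$. *)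

theory Defs
  imports "HOL-Probability.Probability"
begin

text \<open>
  Suprema are taken in \<^typ>\<open>ereal\<close>, so that an unbounded set of values gives \<open>\<infinity>\<close>
  rather than an unspecified real number.
\<close>

definition total_variation :: "(real \<Rightarrow> real) \<Rightarrow> ereal" where
  "total_variation h =
    (SUP (m, t) \<in> {(m::nat, t::nat \<Rightarrow> real). strict_mono_on {0..m} t}.
      ereal (\<Sum>i=1..m. \<bar>h (t i) - h (t (i - 1))\<bar>))"

definition continuously_differentiable :: "nat \<Rightarrow> (real \<Rightarrow> real) \<Rightarrow> bool" where
  "continuously_differentiable n h \<longleftrightarrow>
    (\<forall>j<n. (deriv ^^ j) h differentiable_on UNIV) \<and> continuous_on UNIV ((deriv ^^ n) h)"

text \<open>
  A set \<open>P\<close> of pairs encodes a finite family of pairwise non-overlapping intervals.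
  The library constant \<open>absolutely_continuous\<close> concerns measures, not functions.
\<close>

definition absolutely_continuous_fun_on :: "real set \<Rightarrow> (real \<Rightarrow> real) \<Rightarrow> bool" where
  "absolutely_continuous_fun_on S h \<longleftrightarrow>
    (\<forall>\<epsilon>>0. \<exists>\<delta>>0. \<forall>P :: (real \<times> real) set.
      finite P \<longrightarrow>
      (\<forall>(u, v)\<in>P. u < v \<and> {u..v} \<subseteq> S) \<longrightarrow>
      disjoint_family_on (\<lambda>(u, v). {u<..<v}) P \<longrightarrow>
      (\<Sum>(u, v)\<in>P. v - u) < \<delta> \<longrightarrow>
      (\<Sum>(u, v)\<in>P. \<bar>h v - h u\<bar>) < \<epsilon>)"

definition locally_absolutely_continuous :: "(real \<Rightarrow> real) \<Rightarrow> bool" where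
  "locally_absolutely_continuous h \<longleftrightarrow> (\<forall>a b. absolutely_continuous_fun_on {a..b} h)"

text \<open>The next two notions are meant for \<open>k \<ge> 1\<close> only.\<close>

definition times_absolutely_continuous :: "nat \<Rightarrow> (real \<Rightarrow> real) \<Rightarrow> bool" where
  "times_absolutely_continuous k h \<longleftrightarrow>
    continuously_differentiable (k - 1) h \<and>
    locally_absolutely_continuous ((deriv ^^ (k - 1)) h)"

text \<open>
  \<open>g\<close> is a version of the \<open>k\<close>-th derivative of \<open>h\<close>. Local integrability need not be required:
  the almost everywhere derivative of a locally absolutely continuous function has it.
\<close>

definition version_of_deriv :: "nat \<Rightarrow> (real \<Rightarrow> real) \<Rightarrow> (real \<Rightarrow> real) \<Rightarrow> bool" where
  "version_of_deriv k h g \<longleftrightarrow>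
    (AE x in lebesgue. ((deriv ^^ (k - 1)) h has_real_derivative g x) (at x))"

definition KD :: "(real \<Rightarrow> real) \<Rightarrow> ereal" where
  "KD G = (SUP (x, y) \<in> {(x, y). 0 \<le> x \<and> x < y \<and> y \<le> 1}.
    ereal \<bar>G y - G x - (y - x)\<bar>)"

definition MRAE :: "(real \<Rightarrow> real) \<Rightarrow> ereal" where
  "MRAE G = (SUP (x, y) \<in> {(x, y). 0 \<le> x \<and> x < y \<and> y \<le> 1}.
    ereal \<bar>(G y - G x) / (y - x) - 1\<bar>)"

end

theory Submission
  imports Defs "HOL-Real_Asymp.Real_Asymp"
begin

text \<open>
  Put \<open>d = y - x\<close>. Summing over integer translates, \<open>G y - G x - d\<close> is the integral of \<open>f\<close> against the
  1-periodic extension of the indicator function of \<open>{x..y}\<close> minus \<open>d\<close>. Integrating by parts \<open>k\<close> times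
  replaces \<open>f\<close> by \<open>f\<^sup>(\<^sup>k\<^sup>)\<close> and this function by its \<open>k\<close>-th periodic primitive of mean zero; the boundary
  terms vanish because the distribution function converges at both ends and \<open>f\<^sup>(\<^sup>k\<^sup>)\<close> has bounded variation,
  which forces all derivatives of \<open>f\<close> to tend to 0. The periodization of \<open>f\<^sup>(\<^sup>k\<^sup>)\<close> has oscillation at
  most \<open>TV / 2\<close>, so the integral is at most \<open>TV / 4\<close> times the \<open>L\<^sup>1\<close> norm of the primitive. The first
  primitive is piecewise linear with \<open>L\<^sup>2\<close> norm \<open>d (1 - d) / sqrt 12\<close>, and by Wirtinger's inequality every
  further primitive gains a factor \<open>1/6\<close> in \<open>L\<^sup>2\<close> (the optimal factor is \<open>1 / (2 pi)\<close>). Since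
  \<open>1 / sqrt 12 \<le> 1/3\<close>, this gives the claim.
\<close>

section \<open>Absolutely continuous functions\<close>

text \<open>The obstacle is the last integration by parts: the derivative of order
  \<open>k - 1\<close> is only absolutely continuous, and \<open>g\<close> is its derivative merely
  almost everywhere. The fundamental theorem is therefore proved for the gauge integral, where
  integrability of \<open>g\<close> comes out as a conclusion. A second obstacle is convergence. The
  periodized series over all integers is never formed: everything happens on the window from
  \<open>- N\<close> to \<open>N\<close>, where boundary terms of adjacent unit cells cancel and
  only those at the two ends of the window remain. The constants fit together as follows. One half
  of the variation is lost to the oscillation of the periodized function, another half to centring
  it, and 1/4 * 1/3 = 1 / (2 * 6) accounts for the first primitive; the other \<open>k - 1\<close>
  primitives contribute 1/6 each.\<close>

text \<open>Enclose \<open>N\<close> in an open set \<open>T\<close> of measure below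
  \<open>\<delta>\<close> and let the gauge consist of balls inside \<open>T\<close>. Intervals
  tagged in \<open>N\<close> then lie in \<open>T\<close>, so their total length is below
  \<open>\<delta>\<close> and absolute continuity applies.\<close>

lemma absolutely_continuous_null_tags:
  fixes F :: "real \<Rightarrow> real"
  assumes ac: "absolutely_continuous_fun_on {a..b} F" and N: "negligible N" and e: "0 < e"
  obtains \<gamma> where "gauge \<gamma>"
    and "\<And>q. q tagged_partial_division_of {a..b} \<Longrightarrow> \<gamma> fine q \<Longrightarrow> fst ` q \<subseteq> N \<Longrightarrow>
      (\<Sum>(x, K)\<in>q. \<bar>F (Sup K) - F (Inf K)\<bar>) < e"
proof -
  obtain \<delta> where "\<delta> > 0" and \<delta>: "\<And>P :: (real \<times> real) set. finite P \<Longrightarrow>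
      \<forall>(u, v)\<in>P. u < v \<and> {u..v} \<subseteq> {a..b} \<Longrightarrow> disjoint_family_on (\<lambda>(u, v). {u<..<v}) P \<Longrightarrow>
      (\<Sum>(u, v)\<in>P. v - u) < \<delta> \<Longrightarrow> (\<Sum>(u, v)\<in>P. \<bar>F v - F u\<bar>) < e"
    using ac[unfolded absolutely_continuous_fun_on_def, rule_format, OF e] by blast
  have "N \<in> sets lebesgue" and N0: "emeasure lebesgue N = 0"
    using N by (auto simp: negligible_iff_null_sets)
  then obtain T where T: "open T" "N \<subseteq> T" "T - N \<in> lmeasurable"
    "emeasure lebesgue (T - N) < ennreal \<delta>"
    using sets_lebesgue_outer_open \<open>\<delta> > 0\<close> by metis
  have [measurable]: "T \<in> sets lebesgue" using T(1) by auto
  have "emeasure lebesgue T \<le> emeasure lebesgue N + emeasure lebesgue (T - N)"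
    using emeasure_subadditive[of N lebesgue "T - N"] \<open>N \<in> sets lebesgue\<close> T(2)
    by (simp add: Un_absorb1)
  then have T\<delta>: "emeasure lebesgue T < ennreal \<delta>"
    using T(4) N0 by (simp add: order_le_less_trans)
  have Tm: "T \<in> lmeasurable"
    using order_less_trans[OF T\<delta> ennreal_less_top] by (intro fmeasurableI) auto
  have "\<exists>r>0. x \<in> T \<longrightarrow> ball x r \<subseteq> T" for x
    by (metis T(1) open_contains_ball zero_less_one)
  then obtain r where r: "\<And>x. r x > (0::real)" "\<And>x. x \<in> T \<Longrightarrow> ball x (r x) \<subseteq> T"
    by metis
  show thesis
  proof
    show "gauge (\<lambda>x. ball x (r x))" using r by (simp add: gauge_ball_dependent)
  next
    fix q assume q: "q tagged_partial_division_of {a..b}" and fine: "(\<lambda>x. ball x (r x)) fine q"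
      and tags: "fst ` q \<subseteq> N"
    note qD = tagged_partial_division_ofD[OF q]
    \<comment> \<open>Degenerate intervals are dropped because the definition of absolute continuity
      asks for \<open>u < v\<close>. The remaining ones have disjoint nonempty interiors, so passing
      from tagged intervals to pairs of end points by \<open>h\<close> is injective and no increment
      is lost.\<close>
    define p where "p = {z \<in> q. Inf (snd z) < Sup (snd z)}"
    define h where "h = (\<lambda>z::real \<times> real set. (Inf (snd z), Sup (snd z)))"
    have p: "p \<subseteq> q" "finite p" using qD(1) by (auto simp: p_def)
    have Keq: "K = {Inf K..Sup K}" if "(x, K) \<in> p" for x K
    proof -
      obtain u v where "K = cbox u v" "x \<in> K"
        using \<open>(x, K) \<in> p\<close> p(1) qD(2,4) by blast
      then show ?thesis by (cases "u \<le> v") auto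
    qed
    have int: "interior K = {Inf K<..<Sup K}" if "(x, K) \<in> p" for x K
      using Keq[OF that] by (metis interior_atLeastAtMost_real)
    have disj: "{Inf K<..<Sup K} \<inter> {Inf K'<..<Sup K'} = {}"
      if "(x, K) \<in> p" "(x', K') \<in> p" "(x, K) \<noteq> (x', K')" for x K x' K'
      using qD(5)[of x K x' K'] that p(1) int[OF that(1)] int[OF that(2)] by auto
    have inj: "inj_on h p"
    proof (rule inj_onI, rule ccontr)
      fix z z' assume z: "z \<in> p" "z' \<in> p" "h z = h z'" "z \<noteq> z'"
      then have "{Inf (snd z)<..<Sup (snd z)} \<inter> {Inf (snd z')<..<Sup (snd z')} = {}"
        using disj[of "fst z" "snd z" "fst z'" "snd z'"] by simp
      moreover have "{Inf (snd z)<..<Sup (snd z)} \<noteq> {}" using z(1) by (auto simp: p_def)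
      ultimately show False using z(3) by (auto simp: h_def)
    qed
    have dfam: "disjoint_family_on (\<lambda>(u, v). {u<..<v}) (h ` p)"
      unfolding disjoint_family_on_def
    proof (intro ballI impI)
      fix z z' assume "z \<in> h ` p" "z' \<in> h ` p" "z \<noteq> z'"
      then obtain w w' where *: "w \<in> p" "w' \<in> p" "w \<noteq> w'" "z = h w" "z' = h w'"
        by blast
      then show "(case z of (u, v) \<Rightarrow> {u<..<v}) \<inter> (case z' of (u, v) \<Rightarrow> {u<..<v}) = {}"
        using disj[of "fst w" "snd w" "fst w'" "snd w'"] by (simp add: h_def)
    qed
    have "u < v \<and> {u..v} \<subseteq> {a..b}" if uv: "(u, v) \<in> h ` p" for u v
    proof -
      obtain x K where *: "(x, K) \<in> p" "(u, v) = h (x, K)" using uv by auto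
      then show ?thesis
        using qD(3)[of x K] p(1) Keq[OF *(1)] by (auto simp: h_def p_def)
    qed
    then have sub: "\<forall>(u, v)\<in>h ` p. u < v \<and> {u..v} \<subseteq> {a..b}" by blast
    have inT: "{u<..<v} \<subseteq> T" if "(u, v) \<in> h ` p" for u v
    proof -
      obtain x K where *: "(x, K) \<in> p" "(u, v) = h (x, K)" using \<open>(u, v) \<in> h ` p\<close> by auto
      then have "(x, K) \<in> q" using p by auto
      then have "K \<subseteq> ball x (r x)" "x \<in> T" using fine tags T(2) by (force simp: fine_def)+
      then have "K \<subseteq> T" using r(2) by blast
      then show ?thesis using Keq[OF *(1)] *(2) by (force simp: h_def)
    qed
    have len: "(\<Sum>(u, v)\<in>h ` p. v - u) < \<delta>"
    proof -
      have "(\<Sum>(u, v)\<in>h ` p. v - u) = (\<Sum>z\<in>h ` p. measure lebesgue ((\<lambda>(u, v). {u<..<v}) z))"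
        using sub by (intro sum.cong) auto
      also have "\<dots> = measure lebesgue (\<Union>z\<in>h ` p. (\<lambda>(u, v). {u<..<v}) z)"
        by (rule measure_finite_Union[symmetric]) (use p dfam sub in auto)
      also have "\<dots> \<le> measure lebesgue T"
      proof (rule measure_mono_fmeasurable)
        show "T \<in> lmeasurable" by (rule Tm)
        show "(\<Union>z\<in>h ` p. (\<lambda>(u, v). {u<..<v}) z) \<subseteq> T" using inT by fastforce
        show "(\<Union>z\<in>h ` p. (\<lambda>(u, v). {u<..<v}) z) \<in> sets lebesgue"
          using p(2) by (intro sets.finite_UN) (auto split: prod.split)
      qed
      also have "\<dots> < \<delta>"
        using T\<delta> emeasure_eq_measure2[OF Tm] by (simp add: ennreal_less_iff)
      finally show ?thesis .
    qed
    have "(\<Sum>(x, K)\<in>q. \<bar>F (Sup K) - F (Inf K)\<bar>) = (\<Sum>(x, K)\<in>p. \<bar>F (Sup K) - F (Inf K)\<bar>)"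
    proof (rule sum.mono_neutral_right[OF qD(1) p(1)], clarify)
      fix x K assume "(x, K) \<in> q" "(x, K) \<notin> p"
      moreover obtain u v where "K = cbox u v" "x \<in> K" using \<open>(x, K) \<in> q\<close> qD(2,4) by blast
      ultimately have "Sup K = Inf K" by (auto simp: p_def)
      then show "\<bar>F (Sup K) - F (Inf K)\<bar> = 0" by simp
    qed
    also have "\<dots> = (\<Sum>(u, v)\<in>h ` p. \<bar>F v - F u\<bar>)"
      unfolding sum.reindex[OF inj] by (simp add: h_def case_prod_unfold)
    also have "\<dots> < e"
      using \<delta>[of "h ` p"] p(2) sub dfam len by blast
    finally show "(\<Sum>(x, K)\<in>q. \<bar>F (Sup K) - F (Inf K)\<bar>) < e" .
  qed
qed

text \<open>The Riemann sum error splits by tags. Tags outside \<open>N\<close> are controlled by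
  differentiability, tags in \<open>N\<close> by
  \<open>absolutely_continuous_null_tags\<close>.\<close>

theorem fundamental_theorem_of_calculus_absolutely_continuous:
  fixes F F' :: "real \<Rightarrow> real"
  assumes ab: "a \<le> b" and ac: "absolutely_continuous_fun_on {a..b} F" and N: "negligible N"
    and deriv: "\<And>x. x \<in> {a..b} - N \<Longrightarrow> (F has_real_derivative F' x) (at x within {a..b})"
  shows "(F' has_integral (F b - F a)) {a..b}"
proof -
  \<comment> \<open>With the value 0 on \<open>N\<close>, an interval tagged there contributes
    exactly the increment of \<open>F\<close> to the error.\<close>
  define f where "f x = (if x \<in> N then 0 else F' x)" for x
  have "(f has_integral (F b - F a)) (cbox a b)"
    unfolding has_integral
  proof (intro allI impI)
    fix e :: real assume "0 < e"
    \<comment> \<open>The added 1 keeps the denominator positive when \<open>a = b\<close>.\<close>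
    define \<eta> where "\<eta> = e / (2 * (b - a + 1))"
    have "\<eta> > 0" "\<eta> * (b - a) \<le> e / 2"
      using \<open>0 < e\<close> ab by (auto simp: \<eta>_def divide_simps intro!: mult_nonneg_nonneg)
    obtain \<gamma> where \<gamma>: "gauge \<gamma>" and \<gamma>sum: "\<And>q. q tagged_partial_division_of {a..b} \<Longrightarrow>
        \<gamma> fine q \<Longrightarrow> fst ` q \<subseteq> N \<Longrightarrow> (\<Sum>(x, K)\<in>q. \<bar>F (Sup K) - F (Inf K)\<bar>) < e / 2"
      using absolutely_continuous_null_tags[OF ac N, of "e / 2"] half_gt_zero[OF \<open>0 < e\<close>] by blast
    have "\<exists>d>0. x \<in> {a..b} - N \<longrightarrow>
        (\<forall>y\<in>{a..b}. \<bar>y - x\<bar> < d \<longrightarrow> \<bar>F y - F x - F' x * (y - x)\<bar> \<le> \<eta> * \<bar>y - x\<bar>)" for x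
    proof (cases "x \<in> {a..b} - N")
      case True
      have "(F has_derivative (*) (F' x)) (at x within {a..b})"
        using deriv[OF True] by (simp add: has_field_derivative_def)
      then show ?thesis
        using \<open>\<eta> > 0\<close> unfolding has_derivative_within_alt by (auto simp: real_norm_def)
    qed (auto intro: zero_less_one)
    then obtain d where d0: "\<And>x. d x > 0" and d: "\<And>x y. x \<in> {a..b} \<Longrightarrow> x \<notin> N \<Longrightarrow> y \<in> {a..b} \<Longrightarrow>
        \<bar>y - x\<bar> < d x \<Longrightarrow> \<bar>F y - F x - F' x * (y - x)\<bar> \<le> \<eta> * \<bar>y - x\<bar>"
      by (metis DiffI)
    show "\<exists>\<gamma>. gauge \<gamma> \<and> (\<forall>p. p tagged_division_of cbox a b \<and> \<gamma> fine p \<longrightarrow>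
        norm ((\<Sum>(x, K)\<in>p. measure lborel K *\<^sub>R f x) - (F b - F a)) < e)"
    proof (intro exI conjI allI impI; (elim conjE)?)
      show "gauge (\<lambda>x. \<gamma> x \<inter> ball x (d x))"
        using \<gamma> d0 by (intro gauge_Int gauge_ball_dependent) auto
    next
      fix p assume "p tagged_division_of cbox a b" and fine: "(\<lambda>x. \<gamma> x \<inter> ball x (d x)) fine p"
      then have p: "p tagged_division_of {a..b}" by simp
      then have pp: "p tagged_partial_division_of {a..b}" by (simp add: tagged_division_of_def)
      define q where "q = {z \<in> p. fst z \<in> N}"
      have fp: "finite p" using p by blast
      have q: "q \<subseteq> p" by (auto simp: q_def)
      have qsum: "(\<Sum>(x, K)\<in>q. \<bar>F (Sup K) - F (Inf K)\<bar>) < e / 2"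
        using fine by (intro \<gamma>sum tagged_partial_division_subset[OF pp q])
          (auto simp: fine_def q_def)
      define err where "err = (\<lambda>(x, K). measure lborel K * f x - (F (Sup K) - F (Inf K)))"
      have *: "(\<Sum>(x, K)\<in>p. measure lborel K *\<^sub>R f x) - (F b - F a) = sum err p"
        using additive_tagged_division_1[OF ab p, of F]
        by (simp add: err_def sum_subtractf case_prod_unfold)
      have qerr: "\<bar>err (x, K)\<bar> = \<bar>F (Sup K) - F (Inf K)\<bar>" if "(x, K) \<in> q" for x K
        using that by (auto simp: err_def f_def q_def)
      have perr: "\<bar>err (x, K)\<bar> \<le> \<eta> * (Sup K - Inf K)" if xK: "(x, K) \<in> p - q" for x K
      proof -
        obtain u v where K: "K = {u..v}" and x: "x \<in> K" "K \<subseteq> {a..b}"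
          using p xK by (metis DiffD1 box_real(2) tagged_division_ofD(2,3,4))
        then have uv: "u \<le> x" "x \<le> v" "u \<le> v" by auto
        have "x \<notin> N" using xK by (auto simp: q_def)
        have "K \<subseteq> ball x (d x)" using fine xK by (auto simp: fine_def)
        moreover have "u \<in> K" "v \<in> K" using uv K by auto
        \<comment> \<open>Straddle estimate: the tag lies between the end points, so the two
          one-sided errors add up to at most \<open>\<eta>\<close> times the length of
          \<open>K\<close>.\<close>
        ultimately have "\<bar>F u - F x - F' x * (u - x)\<bar> \<le> \<eta> * \<bar>u - x\<bar>"
            "\<bar>F v - F x - F' x * (v - x)\<bar> \<le> \<eta> * \<bar>v - x\<bar>"
          using x \<open>x \<notin> N\<close> by (intro d; auto simp: dist_real_def)+
        moreover have "err (x, K) = (F u - F x - F' x * (u - x)) - (F v - F x - F' x * (v - x))"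
          using K uv \<open>x \<notin> N\<close> by (simp add: err_def f_def algebra_simps)
        moreover have "\<bar>u - x\<bar> = x - u" "\<bar>v - x\<bar> = v - x" using uv by auto
        ultimately have "\<bar>err (x, K)\<bar> \<le> \<eta> * (x - u) + \<eta> * (v - x)"
          by (metis abs_triangle_ineq4 add_mono order_trans)
        then show ?thesis using K uv by (simp add: algebra_simps)
      qed
      have nonneg: "0 \<le> Sup K - Inf K" if "(x, K) \<in> p" for x K
      proof -
        obtain u v where K: "K = {u..v}" and x: "x \<in> K" "K \<subseteq> {a..b}"
          using p \<open>(x, K) \<in> p\<close> by (metis box_real(2) tagged_division_ofD(2,3,4))
        then show ?thesis by auto
      qed
      have "\<bar>sum err p\<bar> \<le> (\<Sum>z\<in>p. \<bar>err z\<bar>)" by (rule sum_abs)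
      also have "\<dots> = (\<Sum>z\<in>p - q. \<bar>err z\<bar>) + (\<Sum>z\<in>q. \<bar>err z\<bar>)"
        by (rule sum.subset_diff[OF q fp])
      also have "(\<Sum>z\<in>q. \<bar>err z\<bar>) = (\<Sum>(x, K)\<in>q. \<bar>F (Sup K) - F (Inf K)\<bar>)"
        using qerr by (intro sum.cong) auto
      also have "(\<Sum>z\<in>p - q. \<bar>err z\<bar>) \<le> (\<Sum>(x, K)\<in>p - q. \<eta> * (Sup K - Inf K))"
        using perr by (intro sum_mono) auto
      also have "\<dots> \<le> (\<Sum>(x, K)\<in>p. \<eta> * (Sup K - Inf K))"
        using nonneg \<open>\<eta> > 0\<close> by (intro sum_mono2[OF fp]) auto
      also have "\<dots> = \<eta> * (b - a)"
        using additive_tagged_division_1[OF ab p, of "\<lambda>x. x"]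
        by (simp add: case_prod_unfold flip: sum_distrib_left)
      finally show "norm ((\<Sum>(x, K)\<in>p. measure lborel K *\<^sub>R f x) - (F b - F a)) < e"
        using qsum \<open>\<eta> * (b - a) \<le> e / 2\<close> unfolding * by simp
    qed
  qed
  then show ?thesis
    by (intro has_integral_spike[OF N, of _ F' f]) (auto simp: f_def)
qed

text \<open>Common source of two applications: \<open>C = 0\<close> covers Lipschitz functions, and
  both terms together cover the product of \<open>F\<close> with a Lipschitz function.\<close>

lemma absolutely_continuous_fun_on_increment_bound:
  fixes F H :: "real \<Rightarrow> real"
  assumes ac: "absolutely_continuous_fun_on S F" and C: "0 \<le> C" "0 \<le> L"
    and bound: "\<And>u v. u \<in> S \<Longrightarrow> v \<in> S \<Longrightarrow> u < v \<Longrightarrow> \<bar>H v - H u\<bar> \<le> C * \<bar>F v - F u\<bar> + L * (v - u)"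
  shows "absolutely_continuous_fun_on S H"
  unfolding absolutely_continuous_fun_on_def
proof (intro allI impI)
  fix e :: real assume "0 < e"
  define \<epsilon> where "\<epsilon> = e / (2 * (C + 1))"
  have "\<epsilon> > 0" "C * \<epsilon> < e / 2" using \<open>0 < e\<close> C by (auto simp: \<epsilon>_def field_simps)
  obtain \<delta> where "\<delta> > 0" and \<delta>: "\<And>P :: (real \<times> real) set. finite P \<Longrightarrow>
      \<forall>(u, v)\<in>P. u < v \<and> {u..v} \<subseteq> S \<Longrightarrow> disjoint_family_on (\<lambda>(u, v). {u<..<v}) P \<Longrightarrow>
      (\<Sum>(u, v)\<in>P. v - u) < \<delta> \<Longrightarrow> (\<Sum>(u, v)\<in>P. \<bar>F v - F u\<bar>) < \<epsilon>"
    using ac[unfolded absolutely_continuous_fun_on_def, rule_format, OF \<open>\<epsilon> > 0\<close>] by blast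
  define \<delta>' where "\<delta>' = min \<delta> (e / (2 * (L + 1)))"
  have "\<delta>' > 0" using \<open>\<delta> > 0\<close> \<open>0 < e\<close> C by (auto simp: \<delta>'_def)
  moreover have "(\<Sum>(u, v)\<in>P. \<bar>H v - H u\<bar>) < e"
    if P: "finite P" "\<forall>(u, v)\<in>P. u < v \<and> {u..v} \<subseteq> S" "disjoint_family_on (\<lambda>(u, v). {u<..<v}) P"
      "(\<Sum>(u, v)\<in>P. v - u) < \<delta>'" for P :: "(real \<times> real) set"
  proof -
    have "(\<Sum>(u, v)\<in>P. v - u) < \<delta>" using P(4) by (simp add: \<delta>'_def)
    note F = \<delta>[OF P(1-3) this]
    have "u \<in> S \<and> v \<in> S \<and> u < v" if "(u, v) \<in> P" for u v
    proof -
      have "u < v" "{u..v} \<subseteq> S" using P(2) \<open>(u, v) \<in> P\<close> by auto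
      then show ?thesis by auto
    qed
    then have "(\<Sum>(u, v)\<in>P. \<bar>H v - H u\<bar>) \<le> (\<Sum>(u, v)\<in>P. C * \<bar>F v - F u\<bar> + L * (v - u))"
      using bound by (intro sum_mono) auto
    also have "\<dots> = C * (\<Sum>(u, v)\<in>P. \<bar>F v - F u\<bar>) + L * (\<Sum>(u, v)\<in>P. v - u)"
      by (simp add: case_prod_unfold sum.distrib sum_distrib_left)
    also have "\<dots> \<le> C * \<epsilon> + L * \<delta>'"
      using F P(4) C by (intro add_mono mult_left_mono) auto
    also have "L * \<delta>' \<le> L * (e / (2 * (L + 1)))" using C by (intro mult_left_mono) (auto simp: \<delta>'_def)
    also have "\<dots> \<le> e / 2" using \<open>0 < e\<close> C by (simp add: field_simps)
    finally show ?thesis using \<open>C * \<epsilon> < e / 2\<close> by simp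
  qed
  ultimately show "\<exists>\<delta>>0. \<forall>P. finite P \<longrightarrow> (\<forall>(u, v)\<in>P. u < v \<and> {u..v} \<subseteq> S) \<longrightarrow>
      disjoint_family_on (\<lambda>(u, v). {u<..<v}) P \<longrightarrow> (\<Sum>(u, v)\<in>P. v - u) < \<delta> \<longrightarrow>
      (\<Sum>(u, v)\<in>P. \<bar>H v - H u\<bar>) < e"
    by blast
qed

lemma absolutely_continuous_fun_on_id: "absolutely_continuous_fun_on S (\<lambda>x. x)"
  unfolding absolutely_continuous_fun_on_def
proof (intro allI impI)
  fix e :: real assume "0 < e"
  then show "\<exists>\<delta>>0. \<forall>P. finite P \<longrightarrow> (\<forall>(u, v)\<in>P. u < v \<and> {u..v} \<subseteq> S) \<longrightarrow>
      disjoint_family_on (\<lambda>(u, v). {u<..<v}) P \<longrightarrow> (\<Sum>(u, v)\<in>P. v - u) < \<delta> \<longrightarrow>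
      (\<Sum>(u, v)\<in>P. \<bar>v - u\<bar>) < e"
  proof (intro exI[of _ e] conjI allI impI)
    fix P :: "(real \<times> real) set"
    assume "\<forall>(u, v)\<in>P. u < v \<and> {u..v} \<subseteq> S" "(\<Sum>(u, v)\<in>P. v - u) < e"
    moreover from this(1) have "(\<Sum>(u, v)\<in>P. \<bar>v - u\<bar>) = (\<Sum>(u, v)\<in>P. v - u)"
      by (intro sum.cong) auto
    ultimately show "(\<Sum>(u, v)\<in>P. \<bar>v - u\<bar>) < e" by simp
  qed
qed

lemma continuous_on_absolutely_continuous:
  fixes F :: "real \<Rightarrow> real"
  assumes ac: "absolutely_continuous_fun_on {a..b} F"
  shows "continuous_on {a..b} F"
  unfolding continuous_on_iff
proof (intro ballI allI impI)
  fix x e :: real assume x: "x \<in> {a..b}" and e: "0 < e"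
  obtain \<delta> where "\<delta> > 0" and \<delta>: "\<And>P :: (real \<times> real) set. finite P \<Longrightarrow>
      \<forall>(u, v)\<in>P. u < v \<and> {u..v} \<subseteq> {a..b} \<Longrightarrow> disjoint_family_on (\<lambda>(u, v). {u<..<v}) P \<Longrightarrow>
      (\<Sum>(u, v)\<in>P. v - u) < \<delta> \<Longrightarrow> (\<Sum>(u, v)\<in>P. \<bar>F v - F u\<bar>) < e"
    using ac[unfolded absolutely_continuous_fun_on_def, rule_format, OF e] by blast
  have *: "\<bar>F v - F u\<bar> < e" if "u < v" "u \<in> {a..b}" "v \<in> {a..b}" "v - u < \<delta>" for u v
    using \<delta>[of "{(u, v)}"] that by (auto simp: disjoint_family_on_def)
  have "dist (F y) (F x) < e" if "y \<in> {a..b}" "dist y x < \<delta>" for y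
    using *[of x y] *[of y x] that x e by (cases x y rule: linorder_cases) (auto simp: dist_real_def)
  then show "\<exists>d>0. \<forall>x'\<in>{a..b}. dist x' x < d \<longrightarrow> dist (F x') (F x) < e"
    using \<open>\<delta> > 0\<close> by blast
qed

lemma absolutely_continuous_fun_on_mult_lipschitz:
  fixes F H :: "real \<Rightarrow> real"
  assumes ac: "absolutely_continuous_fun_on {a..b} F" and L: "0 \<le> L"
    and lip: "\<And>u v. u \<in> {a..b} \<Longrightarrow> v \<in> {a..b} \<Longrightarrow> \<bar>H v - H u\<bar> \<le> L * \<bar>v - u\<bar>"
  shows "absolutely_continuous_fun_on {a..b} (\<lambda>x. F x * H x)"
proof -
  have "continuous_on {a..b} F" by (rule continuous_on_absolutely_continuous[OF ac])
  then have "bounded (F ` {a..b})" by (intro compact_imp_bounded compact_continuous_image) auto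
  then have "\<exists>B. \<forall>x\<in>{a..b}. \<bar>F x\<bar> \<le> B" by (auto simp: bounded_iff)
  then obtain B where B: "\<And>x. x \<in> {a..b} \<Longrightarrow> \<bar>F x\<bar> \<le> B" by blast
  define C where "C = \<bar>H a\<bar> + L * (b - a)"
  have C: "\<bar>H x\<bar> \<le> C" if "x \<in> {a..b}" for x
    using lip[of a x] L that mult_left_mono[of "x - a" "b - a" L] unfolding C_def by auto
  show ?thesis
  proof (rule absolutely_continuous_fun_on_increment_bound[OF ac, of "\<bar>C\<bar>" "\<bar>B\<bar> * L"])
    fix u v assume uv: "u \<in> {a..b}" "v \<in> {a..b}" "u < v"
    have "F v * H v - F u * H u = (F v - F u) * H v + F u * (H v - H u)"
      by (simp add: algebra_simps)
    then have "\<bar>F v * H v - F u * H u\<bar> \<le> \<bar>F v - F u\<bar> * \<bar>H v\<bar> + \<bar>F u\<bar> * \<bar>H v - H u\<bar>"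
      by (metis abs_mult abs_triangle_ineq)
    also have "\<dots> \<le> \<bar>F v - F u\<bar> * \<bar>C\<bar> + \<bar>B\<bar> * (L * \<bar>v - u\<bar>)"
      using C[OF uv(2)] B[OF uv(1)] lip[OF uv(1,2)]
      by (intro add_mono mult_mono) auto
    finally show "\<bar>F v * H v - F u * H u\<bar> \<le> \<bar>C\<bar> * \<bar>F v - F u\<bar> + \<bar>B\<bar> * L * (v - u)"
      using uv by (simp add: algebra_simps)
  qed (use L in auto)
qed

text \<open>The fundamental theorem applies to \<open>F * H\<close>, which is absolutely continuous.
  Integrability of \<open>F' * H\<close> is then obtained by subtraction, which suits an
  \<open>F'\<close> known only almost everywhere.\<close>

lemma has_integral_by_parts_absolutely_continuous:
  fixes F F' H H' :: "real \<Rightarrow> real"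
  assumes ab: "a \<le> b" and ac: "absolutely_continuous_fun_on {a..b} F" and N: "negligible N"
    and F': "\<And>x. x \<in> {a..b} - N \<Longrightarrow> (F has_real_derivative F' x) (at x within {a..b})"
    and L: "0 \<le> L" and lip: "\<And>u v. u \<in> {a..b} \<Longrightarrow> v \<in> {a..b} \<Longrightarrow> \<bar>H v - H u\<bar> \<le> L * \<bar>v - u\<bar>"
    and H': "\<And>x. x \<in> {a..b} - N \<Longrightarrow> (H has_real_derivative H' x) (at x within {a..b})"
    and I: "((\<lambda>x. F x * H' x) has_integral I) {a..b}"
  shows "((\<lambda>x. F' x * H x) has_integral (F b * H b - F a * H a - I)) {a..b}"
proof -
  have "((\<lambda>x. F' x * H x + F x * H' x) has_integral (F b * H b - F a * H a)) {a..b}"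
  proof (rule fundamental_theorem_of_calculus_absolutely_continuous[OF ab _ N])
    show "absolutely_continuous_fun_on {a..b} (\<lambda>x. F x * H x)"
      by (rule absolutely_continuous_fun_on_mult_lipschitz[OF ac L lip])
    show "((\<lambda>x. F x * H x) has_real_derivative F' x * H x + F x * H' x) (at x within {a..b})"
      if "x \<in> {a..b} - N" for x
      using DERIV_mult[OF F'[OF that] H'[OF that]] by (simp add: algebra_simps)
  qed
  from has_integral_diff[OF this I] show ?thesis by simp
qed

section \<open>Total variation and decay of derivatives\<close>

lemma sum_le_total_variation:
  fixes m :: nat and t :: "nat \<Rightarrow> real"
  assumes "strict_mono_on {0..m} t"
  shows "ereal (\<Sum>i=1..m. \<bar>h (t i) - h (t (i - 1))\<bar>) \<le> total_variation h"
  using SUP_upper[of "(m, t)" "{(m, t). strict_mono_on {0..m} t}"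
      "\<lambda>(m, t). ereal (\<Sum>i=1..m. \<bar>h (t i) - h (t (i - 1))\<bar>)"] assms
  by (simp add: total_variation_def del: One_nat_def)

lemma total_variation_nonneg: "0 \<le> total_variation h"
proof -
  have "strict_mono_on {0..0} real" by (rule strict_mono_onI) simp
  from sum_le_total_variation[OF this] show ?thesis by (simp add: zero_ereal_def)
qed

text \<open>Reversing a partition preserves its sum. This reduces the behaviour of \<open>g\<close>
  at minus infinity to that at plus infinity.\<close>

lemma total_variation_reflect_le: "total_variation (\<lambda>x. h (- x)) \<le> total_variation h"
  unfolding total_variation_def[of "\<lambda>x. h (- x)"]
proof (rule SUP_least, clarify)
  fix m :: nat and t :: "nat \<Rightarrow> real" assume t: "strict_mono_on {0..m} t"
  define s where "s i = - t (m - i)" for i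
  have s: "strict_mono_on {0..m} s"
    using t by (auto simp: strict_mono_on_def s_def)
  have "(\<Sum>i=1..m. \<bar>h (- t i) - h (- t (i - 1))\<bar>) = (\<Sum>i=1..m. \<bar>h (s i) - h (s (i - 1))\<bar>)"
    by (rule sum.reindex_bij_witness[of _ "\<lambda>i. m + 1 - i" "\<lambda>i. m + 1 - i"])
      (auto simp: s_def abs_minus_commute Suc_diff_le intro!: arg_cong2[of _ _ _ _ "\<lambda>x y. \<bar>h (- t x) - h (- t y)\<bar>"])
  then show "ereal (\<Sum>i=1..m. \<bar>h (- t i) - h (- t (i - 1))\<bar>) \<le> total_variation h"
    using sum_le_total_variation[OF s] by simp
qed

text \<open>Take a partition whose variation is within \<open>e\<close> of the supremum, and append two points.\<close>

lemma finite_total_variation_Cauchy_at_top: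
  assumes tv: "total_variation g < \<infinity>" and e: "0 < e"
  shows "\<exists>X. \<forall>a>X. \<forall>b>a. \<bar>g b - g a\<bar> \<le> e"
proof -
  obtain V where V: "total_variation g = ereal V"
    using tv total_variation_nonneg[of g] by (cases "total_variation g") auto
  have "ereal (V - e) < total_variation g" using V e by simp
  then obtain z where z: "z \<in> {(m::nat, t::nat \<Rightarrow> real). strict_mono_on {0..m} t}"
    "ereal (V - e) < (\<lambda>(m, t). ereal (\<Sum>i=1..m. \<bar>g (t i) - g (t (i - 1))\<bar>)) z"
    unfolding total_variation_def less_SUP_iff by blast
  obtain m t where "z = (m, t)" by (cases z)
  with z have t: "strict_mono_on {0..m} t"
    and sum: "V - e < (\<Sum>i=1..m. \<bar>g (t i) - g (t (i - 1))\<bar>)"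
    by simp_all
  have "\<bar>g b - g a\<bar> \<le> e" if "a > t m" "b > a" for a b
  proof -
    define s where "s i = (if i \<le> m then t i else if i = Suc m then a else b)" for i
    have tm: "t i \<le> t m" if "i \<le> m" for i
      using strict_mono_onD[OF t, of i m] \<open>i \<le> m\<close> by (cases "i = m") auto
    have "strict_mono_on {0..Suc (Suc m)} s"
    proof (rule strict_mono_onI)
      fix i j assume ij: "i \<in> {0..Suc (Suc m)}" "j \<in> {0..Suc (Suc m)}" "i < j"
      consider "j \<le> m" | "i \<le> m" "j > m" | "i = Suc m" "j = Suc (Suc m)" using ij by (cases "j \<le> m"; cases "i \<le> m") auto
      then show "s i < s j"
      proof cases
        case 1
        then show ?thesis using t ij by (auto simp: s_def strict_mono_on_def)
      next
        case 2
        then show ?thesis using tm[of i] that by (auto simp: s_def)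
      qed (use that in \<open>auto simp: s_def\<close>)
    qed
    then have "(\<Sum>i=1..Suc (Suc m). \<bar>g (s i) - g (s (i - 1))\<bar>) \<le> V"
      using sum_le_total_variation[of "Suc (Suc m)" s g] V by simp
    moreover have "(\<Sum>i=1..m. \<bar>g (s i) - g (s (i - 1))\<bar>) = (\<Sum>i=1..m. \<bar>g (t i) - g (t (i - 1))\<bar>)"
      by (intro sum.cong) (auto simp: s_def)
    ultimately show ?thesis using sum by (simp add: s_def)
  qed
  then show ?thesis by blast
qed

section \<open>Iterated unit differences and decay at infinity\<close>

definition forward_diff :: "(real \<Rightarrow> real) \<Rightarrow> real \<Rightarrow> real" where
  "forward_diff h x = h (x + 1) - h x"

lemma forward_diff_has_real_derivative:
  assumes "\<And>x. (h has_real_derivative h' x) (at x)"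
  shows "(forward_diff h has_real_derivative forward_diff h' x) (at x)"
proof -
  have "((\<lambda>x. h (x + 1)) has_real_derivative h' (x + 1)) (at x)"
    using assms[of "x + 1"] by (simp add: DERIV_shift)
  then show ?thesis
    unfolding forward_diff_def [abs_def] using assms by (intro DERIV_diff) auto
qed

text \<open>The induction passes to the chain of differences \<open>forward_diff (E i)\<close> and
  resolves the last difference by the mean value theorem; hence the formulation for a chain instead
  of a single function.\<close>

lemma forward_diff_iterate_mean_value:
  assumes "\<And>i x. i < m \<Longrightarrow> (E i has_real_derivative E (Suc i) x) (at x)"
  shows "\<exists>\<xi>\<in>{x..x + real m}. (forward_diff ^^ m) (E 0) x = E m \<xi>"
  using assms
proof (induction m arbitrary: E x)
  case 0
  then show ?case by auto
next
  case (Suc m)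
  have "(forward_diff (E i) has_real_derivative forward_diff (E (Suc i)) x) (at x)"
    if "i < m" for i x
    using Suc.prems that by (intro forward_diff_has_real_derivative) auto
  from Suc.IH[of "\<lambda>i. forward_diff (E i)" x, OF this] obtain \<xi> where \<xi>: "\<xi> \<in> {x..x + real m}"
    "(forward_diff ^^ m) (forward_diff (E 0)) x = forward_diff (E m) \<xi>" by blast
  obtain z where z: "\<xi> < z" "z < \<xi> + 1" "E m (\<xi> + 1) - E m \<xi> = (\<xi> + 1 - \<xi>) * E (Suc m) z"
    using MVT2[of \<xi> "\<xi> + 1" "E m" "E (Suc m)"] Suc.prems[of m] by auto
  then have "(forward_diff ^^ Suc m) (E 0) x = E (Suc m) z"
    using \<xi> by (simp only: funpow_Suc_right o_apply) (simp add: forward_diff_def)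
  moreover have "z \<in> {x..x + real (Suc m)}" using z \<xi> by auto
  ultimately show ?case by blast
qed

lemma forward_diff_tendsto:
  assumes "(h \<longlongrightarrow> c) at_top"
  shows "(forward_diff h \<longlongrightarrow> 0) at_top"
proof -
  have "((\<lambda>x. h (x + 1)) \<longlongrightarrow> c) at_top"
    by (rule filterlim_compose[OF assms]) real_asymp
  from tendsto_diff[OF this assms] show ?thesis by (simp add: forward_diff_def [abs_def])
qed

lemma forward_diff_iterate_tendsto:
  assumes "(h \<longlongrightarrow> c) at_top"
  shows "((forward_diff ^^ Suc n) h \<longlongrightarrow> 0) at_top"
  using assms by (induction n) (auto simp del: funpow.simps simp: funpow_Suc_right[of "Suc _"]
    intro: forward_diff_tendsto simp: funpow.simps(2))

text \<open>Convergence of \<open>E 0\<close> makes its iterated differences tend to 0, and these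
  are values of higher derivatives at intermediate points. For \<open>g\<close> this suffices
  because \<open>g\<close> is almost constant far out. Then one descends from \<open>E m\<close>:
  once the next derivative tends to 0, \<open>E i\<close> is almost constant on windows of length
  \<open>m\<close>, and each such window contains a point where \<open>E i\<close> equals a small
  difference.\<close>

lemma derivatives_tendsto_0_at_top:
  fixes E :: "nat \<Rightarrow> real \<Rightarrow> real" and g :: "real \<Rightarrow> real"
  assumes E0: "(E 0 \<longlongrightarrow> c) at_top"
    and der: "\<And>i x. i < m \<Longrightarrow> (E i has_real_derivative E (Suc i) x) (at x)"
    and int: "\<And>u v. u \<le> v \<Longrightarrow> (g has_integral (E m v - E m u)) {u..v}"
    and Cauchy: "\<And>e. 0 < e \<Longrightarrow> \<exists>X. \<forall>a>X. \<forall>b>a. \<bar>g b - g a\<bar> \<le> e"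
  shows "(g \<longlongrightarrow> 0) at_top"
    and "\<And>i. 1 \<le> i \<Longrightarrow> i \<le> m \<Longrightarrow> (E i \<longlongrightarrow> 0) at_top"
proof -
  show g: "(g \<longlongrightarrow> 0) at_top"
  proof (rule tendstoI)
    fix e :: real assume "0 < e"
    then obtain X where X: "\<And>a b. a > X \<Longrightarrow> b > a \<Longrightarrow> \<bar>g b - g a\<bar> \<le> e / 3"
      using Cauchy[of "e / 3"] by auto
    have "eventually (\<lambda>x. \<bar>(forward_diff ^^ Suc m) (E 0) x\<bar> < e / 3) at_top"
      using tendstoD[OF forward_diff_iterate_tendsto[OF E0, of m], of "e / 3"] \<open>0 < e\<close>
      by (simp add: dist_real_def)
    moreover have "eventually (\<lambda>x. X < x) at_top" by (rule eventually_gt_at_top)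
    ultimately show "eventually (\<lambda>x. dist (g x) 0 < e) at_top"
    proof eventually_elim
      case (elim x)
      \<comment> \<open>Of the \<open>m + 1\<close> differences one is kept aside, since
        \<open>E m\<close> need not be differentiable everywhere. Its increment over a unit interval
        is the integral of \<open>g\<close>, which differs from \<open>g x\<close> by at most
        \<open>e / 3\<close>.\<close>
      have "(forward_diff (E i) has_real_derivative forward_diff (E (Suc i)) x) (at x)"
        if "i < m" for i x
        using der that by (intro forward_diff_has_real_derivative) auto
      from forward_diff_iterate_mean_value[of m "\<lambda>i. forward_diff (E i)" x, OF this]
      obtain \<xi> where \<xi>: "\<xi> \<in> {x..x + real m}"
        "(forward_diff ^^ m) (forward_diff (E 0)) x = forward_diff (E m) \<xi>" by blast
      then have small: "\<bar>E m (\<xi> + 1) - E m \<xi>\<bar> < e / 3"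
        using elim(1) by (simp only: funpow_Suc_right o_apply) (simp add: forward_diff_def)
      have int': "((\<lambda>y. g y - g x) has_integral (E m (\<xi> + 1) - E m \<xi> - g x * (\<xi> + 1 - \<xi>))) {\<xi>..\<xi> + 1}"
        by (intro has_integral_diff int)
          (use has_integral_const_real[of "g x" \<xi> "\<xi> + 1"] in \<open>auto simp: mult.commute\<close>)
      have Xx: "\<bar>g y - g x\<bar> \<le> e / 3" if "x \<le> y" for y
        using X[of x y] elim(2) that \<open>0 < e\<close> by (cases "x = y") auto
      from has_integral_bound_real[OF _ _ int', of "e / 3" "{}"]
      have "\<bar>E m (\<xi> + 1) - E m \<xi> - g x\<bar> \<le> e / 3"
        using Xx \<open>0 < e\<close> \<xi>(1) by auto
      then show ?case using small \<open>0 < e\<close> unfolding dist_real_def by linarith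
    qed
  qed
  have window: "(E i \<longlongrightarrow> 0) at_top" if "1 \<le> i" "i \<le> m"
    and W: "\<And>e. 0 < e \<Longrightarrow> eventually (\<lambda>x. \<forall>y\<in>{x..x + real m}. \<bar>E i y - E i x\<bar> \<le> e) at_top" for i
  proof (rule tendstoI)
    fix e :: real assume "0 < e"
    obtain n where n: "i = Suc n" using \<open>1 \<le> i\<close> by (cases i) auto
    have "eventually (\<lambda>x. \<bar>(forward_diff ^^ i) (E 0) x\<bar> < e / 2) at_top"
      using tendstoD[OF forward_diff_iterate_tendsto[OF E0, of n], of "e / 2"] \<open>0 < e\<close> n
      by (simp add: dist_real_def)
    moreover have "eventually (\<lambda>x. \<forall>y\<in>{x..x + real m}. \<bar>E i y - E i x\<bar> \<le> e / 2) at_top"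
      using W[of "e / 2"] \<open>0 < e\<close> by simp
    ultimately show "eventually (\<lambda>x. dist (E i x) 0 < e) at_top"
    proof eventually_elim
      case (elim x)
      obtain \<xi> where "\<xi> \<in> {x..x + real i}" "(forward_diff ^^ i) (E 0) x = E i \<xi>"
        using forward_diff_iterate_mean_value[of i E x] der \<open>i \<le> m\<close> by auto
      moreover from this have "\<bar>E i \<xi> - E i x\<bar> \<le> e / 2" using elim(2) \<open>i \<le> m\<close> by auto
      ultimately show ?case using elim(1) unfolding dist_real_def by linarith
    qed
  qed
  \<comment> \<open>The function \<open>h\<close> stands for the derivative of \<open>E n\<close>,
    with \<open>g\<close> in this role for \<open>n = m\<close>; stating it through integrals treats
    both cases at once.\<close>
  have osc: "eventually (\<lambda>x. \<forall>y\<in>{x..x + real m}. \<bar>E n y - E n x\<bar> \<le> e) at_top"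
    if h: "(h \<longlongrightarrow> 0) at_top" "\<And>u v. u \<le> v \<Longrightarrow> (h has_integral (E n v - E n u)) {u..v}"
      and "0 < e" for h n e
  proof -
    define \<epsilon> where "\<epsilon> = e / (real m + 1)"
    have \<epsilon>: "\<epsilon> > 0" "\<epsilon> * real m \<le> e" using \<open>0 < e\<close> by (auto simp: \<epsilon>_def field_simps)
    obtain X where X: "\<And>x. x \<ge> X \<Longrightarrow> \<bar>h x\<bar> < \<epsilon>"
      using tendstoD[OF h(1) \<epsilon>(1)] by (auto simp: eventually_at_top_linorder dist_real_def)
    have "\<bar>E n y - E n x\<bar> \<le> e" if "x \<ge> X" "y \<in> {x..x + real m}" for x y
    proof -
      have "\<bar>h z\<bar> \<le> \<epsilon>" if "z \<in> {x..y}" for z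
        using X[of z] \<open>x \<ge> X\<close> that by auto
      then have "\<bar>E n y - E n x\<bar> \<le> \<epsilon> * (y - x)"
        using has_integral_bound_real[OF _ _ h(2)[of x y], of \<epsilon> "{}"] that \<epsilon> by auto
      also have "\<dots> \<le> \<epsilon> * real m" using that \<epsilon> by (intro mult_left_mono) auto
      finally show ?thesis using \<epsilon>(2) by simp
    qed
    then show ?thesis unfolding eventually_at_top_linorder by blast
  qed
  fix i assume "1 \<le> i" "i \<le> m"
  have "1 \<le> i \<longrightarrow> (E i \<longlongrightarrow> 0) at_top" using \<open>i \<le> m\<close>
  proof (induction rule: inc_induct)
    case base
    show ?case using window osc[OF g int] by blast
  next
    case (step n)
    have "(E (Suc n) has_integral (E n v - E n u)) {u..v}" if "u \<le> v" for u v
      using der[OF \<open>n < m\<close>] that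
      by (intro fundamental_theorem_of_calculus)
        (auto simp flip: has_real_derivative_iff_has_vector_derivative
          intro: has_field_derivative_at_within)
    moreover have "(E (Suc n) \<longlongrightarrow> 0) at_top" using step.IH by simp
    ultimately show ?case using window[of n] osc[of "E (Suc n)" n] \<open>n < m\<close> by auto
  qed
  then show "(E i \<longlongrightarrow> 0) at_top" using \<open>1 \<le> i\<close> by simp
qed

section \<open>Wirtinger's inequality\<close>

text \<open>
  Completing the square in \<open>(h' - w h)\<^sup>2 \<ge> 0\<close> with \<open>w t = - 6 tan (6 (t - c))\<close>, a solution of
  \<open>w' + w\<^sup>2 = - 36\<close>. It is regular for \<open>\<bar>t - c\<bar> \<le> 1/4\<close> because \<open>6/4 < pi/2\<close>.
\<close>

lemma wirtinger_on_short_interval: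
  fixes h h' :: "real \<Rightarrow> real"
  assumes uv: "u \<le> v" "c - 1/4 \<le> u" "v \<le> c + 1/4"
    and deriv: "\<And>t. t \<in> {u..v} \<Longrightarrow> (h has_real_derivative h' t) (at t within {u..v})"
    and cont: "continuous_on {u..v} h'"
  shows "36 * integral {u..v} (\<lambda>t. (h t)\<^sup>2) \<le> integral {u..v} (\<lambda>t. (h' t)\<^sup>2)
    + 6 * (h v)\<^sup>2 * tan (6 * (v - c)) - 6 * (h u)\<^sup>2 * tan (6 * (u - c))"
proof -
  define w where "w t = - 6 * tan (6 * (t - c))" for t
  have cos: "cos (6 * (t - c)) > 0" if "t \<in> {u..v}" for t
    using that uv pi_gt3 by (intro cos_gt_zero_pi) auto
  have w: "(w has_real_derivative - 36 - (w t)\<^sup>2) (at t within {u..v})" if "t \<in> {u..v}" for t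
  proof -
    have "((\<lambda>t. - 6 * tan (6 * (t - c))) has_real_derivative - 36 * inverse ((cos (6 * (t - c)))\<^sup>2))
        (at t within {u..v})"
      using cos[OF that] by (auto intro!: derivative_eq_intros)
    moreover have "inverse ((cos (6 * (t - c)))\<^sup>2) = 1 + (tan (6 * (t - c)))\<^sup>2"
      using tan_sec[of "6 * (t - c)"] cos[OF that] by (simp add: power_inverse)
    ultimately show ?thesis by (simp add: w_def [abs_def] power_mult_distrib)
  qed
  have ch: "continuous_on {u..v} h" using deriv by (rule DERIV_continuous_on)
  have cw: "continuous_on {u..v} w" using w by (rule DERIV_continuous_on)
  have "((\<lambda>t. 2 * h t * h' t * w t + (h t)\<^sup>2 * (- 36 - (w t)\<^sup>2)) has_integral
      (h v)\<^sup>2 * w v - (h u)\<^sup>2 * w u) {u..v}"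
  proof (rule fundamental_theorem_of_calculus[OF uv(1)])
    fix t assume t: "t \<in> {u..v}"
    have "((\<lambda>t. (h t)\<^sup>2 * w t) has_real_derivative
        2 * h t * h' t * w t + (h t)\<^sup>2 * (- 36 - (w t)\<^sup>2)) (at t within {u..v})"
      by (rule derivative_eq_intros deriv[OF t] w[OF t] refl)+ (simp add: algebra_simps)
    then show "((\<lambda>t. (h t)\<^sup>2 * w t) has_vector_derivative
        2 * h t * h' t * w t + (h t)\<^sup>2 * (- 36 - (w t)\<^sup>2)) (at t within {u..v})"
      by (simp add: has_real_derivative_iff_has_vector_derivative)
  qed
  moreover have "((\<lambda>t. (h' t)\<^sup>2) has_integral integral {u..v} (\<lambda>t. (h' t)\<^sup>2)) {u..v}"
    using cont by (intro integrable_integral integrable_continuous_real continuous_intros)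
  moreover have "((\<lambda>t. (h t)\<^sup>2) has_integral integral {u..v} (\<lambda>t. (h t)\<^sup>2)) {u..v}"
    using ch by (intro integrable_integral integrable_continuous_real continuous_intros)
  ultimately have "((\<lambda>t. (h' t)\<^sup>2 - (2 * h t * h' t * w t + (h t)\<^sup>2 * (- 36 - (w t)\<^sup>2)) - 36 * (h t)\<^sup>2)
      has_integral integral {u..v} (\<lambda>t. (h' t)\<^sup>2) - ((h v)\<^sup>2 * w v - (h u)\<^sup>2 * w u)
        - 36 * integral {u..v} (\<lambda>t. (h t)\<^sup>2)) {u..v}"
    by (intro has_integral_diff has_integral_mult_right)
  moreover have "(\<lambda>t. (h' t)\<^sup>2 - (2 * h t * h' t * w t + (h t)\<^sup>2 * (- 36 - (w t)\<^sup>2)) - 36 * (h t)\<^sup>2)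
      = (\<lambda>t. (h' t - h t * w t)\<^sup>2)"
    by (simp add: power2_eq_square algebra_simps)
  ultimately have "((\<lambda>t. (h' t - h t * w t)\<^sup>2)
      has_integral integral {u..v} (\<lambda>t. (h' t)\<^sup>2) - ((h v)\<^sup>2 * w v - (h u)\<^sup>2 * w u)
        - 36 * integral {u..v} (\<lambda>t. (h t)\<^sup>2)) {u..v}"
    by (simp only:)
  then have "0 \<le> integral {u..v} (\<lambda>t. (h' t)\<^sup>2) - ((h v)\<^sup>2 * w v - (h u)\<^sup>2 * w u)
        - 36 * integral {u..v} (\<lambda>t. (h t)\<^sup>2)"
    by (rule has_integral_nonneg) simp
  then show ?thesis by (simp add: w_def algebra_simps)
qed

text \<open>
  By the intermediate value theorem \<open>h a = h (a + 1/2)\<close> for some \<open>a\<close>. Subtracting this value, which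
  can only increase the \<open>L\<^sup>2\<close> norm, makes \<open>h\<close> vanish at the ends of two arcs of length \<open>1/2\<close> that
  make up the circle.
\<close>

lemma wirtinger_periodic:
  fixes h h' :: "real \<Rightarrow> real"
  assumes deriv: "\<And>t. t \<in> {0..1} \<Longrightarrow> (h has_real_derivative h' t) (at t within {0..1})"
    and cont: "continuous_on {0..1} h'" and per: "h 0 = h 1" and mean: "integral {0..1} h = 0"
  shows "36 * integral {0..1} (\<lambda>t. (h t)\<^sup>2) \<le> integral {0..1} (\<lambda>t. (h' t)\<^sup>2)"
proof -
  have ch: "continuous_on {0..1} h" using deriv by (rule DERIV_continuous_on)
  have "\<exists>a. 0 \<le> a \<and> a \<le> 1/2 \<and> h (a + 1/2) - h a = 0"
  proof -
    have c: "continuous_on {0..1/2} (\<lambda>a. h (a + 1/2) - h a)"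
      by (intro continuous_intros continuous_on_compose2[OF ch]) auto
    show ?thesis
    proof (cases "h (1/2) - h 0 \<le> 0")
      case True
      then show ?thesis using IVT'[of "\<lambda>a. h (a + 1/2) - h a" 0 0 "1/2"] c per by auto
    next
      case False
      then show ?thesis using IVT2'[of "\<lambda>a. h (a + 1/2) - h a" "1/2" 0 0] c per by auto
    qed
  qed
  then obtain a where a: "0 \<le> a" "a \<le> 1/2" "h (a + 1/2) = h a" by auto
  define g where "g t = h t - h a" for t
  have g0: "g a = 0" "g (a + 1/2) = 0" "g 1 = g 0" using a per by (auto simp: g_def)
  have dg: "(g has_real_derivative h' t) (at t within S)" if "t \<in> S" "S \<subseteq> {0..1}" for t S
    unfolding g_def [abs_def] using DERIV_subset[OF deriv that(2)] that
    by (auto intro!: derivative_eq_intros)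
  have cg: "continuous_on {0..1} g" unfolding g_def by (intro continuous_intros ch)
  \<comment> \<open>The arc from \<open>a + 1/2\<close> to \<open>a + 1\<close> wraps around, so it
    appears as \<open>{a + 1/2..1}\<close> and \<open>{0..a}\<close>. The centres
    \<open>a + 3/4\<close> and \<open>a - 1/4\<close> agree modulo 1; hence the tangent terms at 1
    and 0 cancel by \<open>g 1 = g 0\<close>, and those at \<open>a\<close> and
    \<open>a + 1/2\<close> vanish with \<open>g\<close>.\<close>
  have I1: "36 * integral {0..a} (\<lambda>t. (g t)\<^sup>2) \<le> integral {0..a} (\<lambda>t. (h' t)\<^sup>2)
    + 6 * (g a)\<^sup>2 * tan (6 * (a - (a - 1/4))) - 6 * (g 0)\<^sup>2 * tan (6 * (0 - (a - 1/4)))"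
    using a by (intro wirtinger_on_short_interval dg continuous_on_subset[OF cont]) auto
  have I2: "36 * integral {a..a + 1/2} (\<lambda>t. (g t)\<^sup>2) \<le> integral {a..a + 1/2} (\<lambda>t. (h' t)\<^sup>2)
    + 6 * (g (a + 1/2))\<^sup>2 * tan (6 * (a + 1/2 - (a + 1/4))) - 6 * (g a)\<^sup>2 * tan (6 * (a - (a + 1/4)))"
    using a by (intro wirtinger_on_short_interval dg continuous_on_subset[OF cont]) auto
  have I3: "36 * integral {a + 1/2..1} (\<lambda>t. (g t)\<^sup>2) \<le> integral {a + 1/2..1} (\<lambda>t. (h' t)\<^sup>2)
    + 6 * (g 1)\<^sup>2 * tan (6 * (1 - (a + 3/4))) - 6 * (g (a + 1/2))\<^sup>2 * tan (6 * (a + 1/2 - (a + 3/4)))"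
    using a by (intro wirtinger_on_short_interval dg continuous_on_subset[OF cont]) auto
  have split: "integral {0..1} f = integral {0..a} f + integral {a..a + 1/2} f + integral {a + 1/2..1} f"
    if "continuous_on {0..1} f" for f :: "real \<Rightarrow> real"
  proof -
    have "f integrable_on {0..1}" by (rule integrable_continuous_real[OF that])
    moreover have "f integrable_on {a..1}"
      using a by (intro integrable_continuous_real continuous_on_subset[OF that]) auto
    ultimately show ?thesis
      using a Henstock_Kurzweil_Integration.integral_combine[of 0 a 1 f]
        Henstock_Kurzweil_Integration.integral_combine[of a "a + 1/2" 1 f] by simp
  qed
  have "36 * integral {0..1} (\<lambda>t. (g t)\<^sup>2) \<le> integral {0..1} (\<lambda>t. (h' t)\<^sup>2)"
  proof -
    have "0 - (a - 1/4) = 1 - (a + 3/4)" by simp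
    then have "36 * integral {0..a} (\<lambda>t. (g t)\<^sup>2) + 36 * integral {a..a + 1/2} (\<lambda>t. (g t)\<^sup>2)
        + 36 * integral {a + 1/2..1} (\<lambda>t. (g t)\<^sup>2) \<le> integral {0..a} (\<lambda>t. (h' t)\<^sup>2)
        + integral {a..a + 1/2} (\<lambda>t. (h' t)\<^sup>2) + integral {a + 1/2..1} (\<lambda>t. (h' t)\<^sup>2)"
      using I1 I2 I3 unfolding g0 by simp
    then show ?thesis
      using split[of "\<lambda>t. (g t)\<^sup>2"] split[of "\<lambda>t. (h' t)\<^sup>2"] cg cont
      by (simp add: continuous_on_power)
  qed
  moreover have "integral {0..1} (\<lambda>t. (g t)\<^sup>2) = integral {0..1} (\<lambda>t. (h t)\<^sup>2) + (h a)\<^sup>2"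
  proof -
    have "((\<lambda>t. (h t)\<^sup>2 - 2 * h a * h t + (h a)\<^sup>2) has_integral
        integral {0..1} (\<lambda>t. (h t)\<^sup>2) - 2 * h a * integral {0..1} h + (h a)\<^sup>2 * (1 - 0)) {0..1}"
      using has_integral_const_real[of "(h a)\<^sup>2" 0 1] ch
      by (intro has_integral_add has_integral_diff has_integral_mult_right integrable_integral
          integrable_continuous_real continuous_intros) (auto simp: mult.commute)
    then have "integral {0..1} (\<lambda>t. (h t)\<^sup>2 - 2 * h a * h t + (h a)\<^sup>2)
        = integral {0..1} (\<lambda>t. (h t)\<^sup>2) + (h a)\<^sup>2"
      using mean by (simp add: integral_unique)
    moreover have "(g t)\<^sup>2 = (h t)\<^sup>2 - 2 * h a * h t + (h a)\<^sup>2" for t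
      by (simp add: g_def power2_eq_square algebra_simps)
    ultimately show ?thesis by simp
  qed
  ultimately show ?thesis using zero_le_power2[of "h a"] by linarith
qed

section \<open>Iterated periodic primitives of mean zero\<close>

definition centred_primitive :: "(real \<Rightarrow> real) \<Rightarrow> real \<Rightarrow> real" where
  "centred_primitive \<psi> t = integral {0..t} \<psi> - integral {0..1} (\<lambda>s. integral {0..s} \<psi>)"

lemma centred_primitive:
  assumes cont: "continuous_on {0..1} \<psi>"
  shows "\<And>t. t \<in> {0..1} \<Longrightarrow> (centred_primitive \<psi> has_real_derivative \<psi> t) (at t within {0..1})"
    and "continuous_on {0..1} (centred_primitive \<psi>)"
    and "integral {0..1} (centred_primitive \<psi>) = 0"
    and "centred_primitive \<psi> 1 - centred_primitive \<psi> 0 = integral {0..1} \<psi>"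
proof -
  have d: "((\<lambda>t. integral {0..t} \<psi>) has_real_derivative \<psi> t) (at t within {0..1})"
    if "t \<in> {0..1}" for t
    using integral_has_real_derivative[OF cont that] .
  then show d': "(centred_primitive \<psi> has_real_derivative \<psi> t) (at t within {0..1})"
    if "t \<in> {0..1}" for t
    using that unfolding centred_primitive_def [abs_def] by (auto intro!: derivative_eq_intros)
  show "continuous_on {0..1} (centred_primitive \<psi>)"
    using d' by (rule DERIV_continuous_on)
  have "continuous_on {0..1} (\<lambda>t. integral {0..t} \<psi>)"
    using d by (rule DERIV_continuous_on)
  then have "(\<lambda>t. integral {0..t} \<psi>) integrable_on {0..1}" by (rule integrable_continuous_real)
  then show "integral {0..1} (centred_primitive \<psi>) = 0"
    unfolding centred_primitive_def [abs_def]
    by (subst Henstock_Kurzweil_Integration.integral_diff) auto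
  show "centred_primitive \<psi> 1 - centred_primitive \<psi> 0 = integral {0..1} \<psi>"
    by (simp add: centred_primitive_def)
qed

text \<open>Mean zero of one function gives its primitive equal values at 0 and 1, and centring
  restores mean zero, so the periodic Wirtinger inequality is available at every stage.\<close>

lemma centred_primitive_iterate:
  assumes "continuous_on {0..1} \<psi>" "integral {0..1} \<psi> = 0" 
  shows "continuous_on {0..1} ((centred_primitive ^^ n) \<psi>)"
    and "integral {0..1} ((centred_primitive ^^ n) \<psi>) = 0"
    and "36 ^ n * integral {0..1} (\<lambda>t. ((centred_primitive ^^ n) \<psi> t)\<^sup>2)
      \<le> integral {0..1} (\<lambda>t. (\<psi> t)\<^sup>2)"
proof (induction n)
  case 0
  { case 1 then show ?case using assms by simp next
    case 2 then show ?case using assms by simp next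
    case 3 then show ?case by simp }
next
  case (Suc n)
  note c = centred_primitive[OF Suc.IH(1)]
  { case 1 then show ?case using c(2) by simp next
    case 2 then show ?case using c(3) by simp next
    case 3
    have "36 * integral {0..1} (\<lambda>t. ((centred_primitive ^^ Suc n) \<psi> t)\<^sup>2)
        \<le> integral {0..1} (\<lambda>t. ((centred_primitive ^^ n) \<psi> t)\<^sup>2)"
      using wirtinger_periodic[OF c(1) Suc.IH(1) _ c(3)] c(4) Suc.IH(2) by simp
    then have "36 ^ n * (36 * integral {0..1} (\<lambda>t. ((centred_primitive ^^ Suc n) \<psi> t)\<^sup>2))
        \<le> 36 ^ n * integral {0..1} (\<lambda>t. ((centred_primitive ^^ n) \<psi> t)\<^sup>2)"
      by (intro mult_left_mono) auto
    also note Suc.IH(3)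
    finally show ?case by (simp add: mult_ac) }
qed

section \<open>Periodization\<close>

text \<open>Since \<open>\<psi>\<close> has mean zero, a constant may be subtracted from
  \<open>P\<close>. The midpoint of the range of \<open>P\<close> leaves a function bounded by half
  the oscillation.\<close>

lemma abs_integral_mult_oscillation_le:
  fixes P \<psi> :: "real \<Rightarrow> real"
  assumes osc: "\<And>s t. s \<in> {0..1} \<Longrightarrow> t \<in> {0..1} \<Longrightarrow> \<bar>P s - P t\<bar> \<le> W"
    and cont: "continuous_on {0..1} \<psi>" and mean: "integral {0..1} \<psi> = 0"
    and I: "((\<lambda>s. P s * \<psi> s) has_integral I) {0..1}"
  shows "\<bar>I\<bar> \<le> W / 2 * integral {0..1} (\<lambda>s. \<bar>\<psi> s\<bar>)"
proof -
  let ?R = "P ` {0..1}"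
  have ne: "?R \<noteq> {}" by simp
  have bd: "P s \<le> P t + W" if "s \<in> {0..1}" "t \<in> {0..1}" for s t
    using osc[OF that] by linarith
  have bdd: "bdd_above ?R" "bdd_below ?R"
    using bd[of _ 0] bd[of 0] by (auto intro!: bdd_aboveI[of _ "P 0 + W"] bdd_belowI[of _ "P 0 - W"] simp: diff_le_eq)
  have "Sup ?R \<le> P t + W" if "t \<in> {0..1}" for t
    using bd that by (intro cSup_least[OF ne]) auto
  then have "Sup ?R - W \<le> Inf ?R"
    by (intro cInf_greatest[OF ne]) (auto simp: diff_le_eq)
  define m where "m = (Sup ?R + Inf ?R) / 2"
  have m: "\<bar>P s - m\<bar> \<le> W / 2" if "s \<in> {0..1}" for s
  proof -
    have "P s \<le> Sup ?R" "Inf ?R \<le> P s"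
      using that bdd by (auto intro: cSup_upper cInf_lower)
    then show ?thesis using \<open>Sup ?R - W \<le> Inf ?R\<close> by (simp add: m_def abs_le_iff field_simps)
  qed
  have "(\<psi> has_integral 0) {0..1}"
    using integrable_integral[OF integrable_continuous_real[OF cont]] mean by simp
  from has_integral_diff[OF I has_integral_mult_right[OF this, of m]]
  have I': "((\<lambda>s. (P s - m) * \<psi> s) has_integral I) {0..1}" by (simp add: algebra_simps)
  have "norm (integral {0..1} (\<lambda>s. (P s - m) * \<psi> s)) \<le> integral {0..1} (\<lambda>s. W / 2 * \<bar>\<psi> s\<bar>)"
  proof (rule integral_norm_bound_integral)
    show "(\<lambda>s. (P s - m) * \<psi> s) integrable_on {0..1}" using I' by blast
    show "(\<lambda>s. W / 2 * \<bar>\<psi> s\<bar>) integrable_on {0..1}"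
      by (intro integrable_continuous_real continuous_intros cont)
    show "norm ((P s - m) * \<psi> s) \<le> W / 2 * \<bar>\<psi> s\<bar>" if "s \<in> {0..1}" for s
      unfolding real_norm_def abs_mult using m[OF that] by (intro mult_right_mono) auto
  qed
  then show ?thesis using integral_unique[OF I'] by simp
qed

text \<open>Cauchy-Schwarz on an interval of length 1, read off from the nonnegative integral of
  \<open>(\<bar>\<psi> s\<bar> - m)\<^sup>2\<close>.\<close>

lemma integral_abs_squared_le:
  fixes \<psi> :: "real \<Rightarrow> real"
  assumes cont: "continuous_on {0..1} \<psi>"
  shows "(integral {0..1} (\<lambda>s. \<bar>\<psi> s\<bar>))\<^sup>2 \<le> integral {0..1} (\<lambda>s. (\<psi> s)\<^sup>2)"
proof -
  define m where "m = integral {0..1} (\<lambda>s. \<bar>\<psi> s\<bar>)"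
  have "((\<lambda>s. (\<psi> s)\<^sup>2 - 2 * m * \<bar>\<psi> s\<bar> + m\<^sup>2) has_integral
      integral {0..1} (\<lambda>s. (\<psi> s)\<^sup>2) - 2 * m * m + m\<^sup>2 * (1 - 0)) {0..1}"
    using has_integral_const_real[of "m\<^sup>2" 0 1]
    unfolding m_def
    by (intro has_integral_add has_integral_diff has_integral_mult_right integrable_integral
        integrable_continuous_real continuous_intros cont) (auto simp: mult.commute)
  moreover have "(\<lambda>s. (\<psi> s)\<^sup>2 - 2 * m * \<bar>\<psi> s\<bar> + m\<^sup>2) = (\<lambda>s. (\<bar>\<psi> s\<bar> - m)\<^sup>2)"
    by (rule ext) (simp add: power2_eq_square algebra_simps)
  ultimately have "((\<lambda>s. (\<bar>\<psi> s\<bar> - m)\<^sup>2) has_integral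
      integral {0..1} (\<lambda>s. (\<psi> s)\<^sup>2) - 2 * m * m + m\<^sup>2 * (1 - 0)) {0..1}" by (simp only:)
  then have "0 \<le> integral {0..1} (\<lambda>s. (\<psi> s)\<^sup>2) - 2 * m * m + m\<^sup>2 * (1 - 0)"
    by (rule has_integral_nonneg) simp
  then show ?thesis by (simp add: m_def power2_eq_square)
qed

lemma sum_pairs: "(\<Sum>j=1..2 * n. a j) = (\<Sum>i<n. a (2 * i + 1) + a (2 * i + 2))"
  for a :: "nat \<Rightarrow> real"
  by (induction n) auto

text \<open>
  Moving from \<open>s\<close> to \<open>t\<close> and from \<open>t\<close> to \<open>s + 1\<close> changes the periodized function by opposite
  amounts, up to the end terms, and the two moves together use the variation of \<open>g\<close> only once.
\<close>

lemma periodization_oscillation_le: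
  fixes N :: nat
  assumes V: "total_variation g \<le> ereal V"
    and ends: "\<And>s. s \<in> {0..1} \<Longrightarrow> \<bar>g (s + real N) - g (s - real N)\<bar> \<le> \<epsilon>"
    and st: "s \<in> {0..1}" "t \<in> {0..1}"
  defines "P \<equiv> \<lambda>s. \<Sum>i<2 * N. g (s + (real i - real N))"
  shows "\<bar>P s - P t\<bar> \<le> (V + \<epsilon>) / 2"
proof -
  have V0: "V \<ge> 0" using V total_variation_nonneg[of g] by (metis ereal_less_eq(5) order_trans)
  have e0: "\<epsilon> \<ge> 0" using ends[of 0] by auto
  have shift: "(\<Sum>i<2 * N. g (s + (real i + 1 - real N))) = P s + g (s + real N) - g (s - real N)" for s
  proof -
    have "(\<Sum>i<n. g (s + (real i + 1 - real N)))
        = (\<Sum>i<n. g (s + (real i - real N))) + g (s + (real n - real N)) - g (s - real N)" for n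
      by (induction n) (auto simp: algebra_simps)
    from this[of "2 * N"] show ?thesis by (simp add: P_def)
  qed
  have main: "\<bar>P s - P t\<bar> \<le> (V + \<epsilon>) / 2" if st: "0 \<le> s" "s < t" "t \<le> 1" for s t
  proof (cases "t < s + 1")
    case True
    \<comment> \<open>The translates of \<open>s\<close> and \<open>t\<close> interlaced:
      \<open>s - N\<close>, \<open>t - N\<close>, \<open>s + 1 - N\<close>, and so on up to
      \<open>s + N\<close>, which is \<open>\<tau> (4 * N)\<close>. Odd steps go from a translate of
      \<open>s\<close> to one of \<open>t\<close>, even steps on to the next translate of
      \<open>s\<close>.\<close>
    define \<tau> where "\<tau> j = (if even j then s else t) + (real (j div 2) - real N)" for j
    have "strict_mono \<tau>"
      unfolding strict_mono_Suc_iff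
    proof
      fix j show "\<tau> j < \<tau> (Suc j)"
        using st True by (cases "even j") (auto simp: \<tau>_def elim!: evenE oddE)
    qed
    then have "strict_mono_on {0..4 * N} \<tau>" by (auto simp: strict_mono_on_def strict_mono_def)
    from sum_le_total_variation[OF this, of g] V
    have "(\<Sum>j=1..2 * (2 * N). \<bar>g (\<tau> j) - g (\<tau> (j - 1))\<bar>) \<le> V"
      by (metis ereal_less_eq(3) mult_2 mult_2_right numeral_Bit0 order_trans mult.assoc distrib_right)
    then have *: "(\<Sum>i<2 * N. \<bar>g (t + (real i - real N)) - g (s + (real i - real N))\<bar>)
        + (\<Sum>i<2 * N. \<bar>g (s + (real i + 1 - real N)) - g (t + (real i - real N))\<bar>) \<le> V"
      unfolding sum_pairs by (simp add: \<tau>_def sum.distrib algebra_simps)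
    have "\<bar>P t - P s\<bar> \<le> (\<Sum>i<2 * N. \<bar>g (t + (real i - real N)) - g (s + (real i - real N))\<bar>)"
      unfolding P_def sum_subtractf[symmetric] by (rule sum_abs)
    moreover have "\<bar>P s + g (s + real N) - g (s - real N) - P t\<bar>
        \<le> (\<Sum>i<2 * N. \<bar>g (s + (real i + 1 - real N)) - g (t + (real i - real N))\<bar>)"
      unfolding shift[symmetric] unfolding P_def sum_subtractf[symmetric] by (rule sum_abs)
    moreover have "\<bar>g (s + real N) - g (s - real N)\<bar> \<le> \<epsilon>" using st by (intro ends) auto
    ultimately show ?thesis using * by (simp add: field_simps abs_if split: if_splits)
  next
    \<comment> \<open>For \<open>t = s + 1\<close> the interlaced points coincide in pairs, but the
      difference telescopes to a single end term. This is at most \<open>\<epsilon>\<close> and at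
      most \<open>V\<close>, hence at most their average.\<close>
    case False
    then have s: "s = 0" "t = 1" using st by auto
    have "P t = P s + g (s + real N) - g (s - real N)"
      unfolding shift[symmetric] unfolding P_def s by (simp add: algebra_simps)
    then have eq: "\<bar>P s - P t\<bar> = \<bar>g (real N) - g (- real N)\<bar>" using s by simp
    moreover have "\<bar>g (real N) - g (- real N)\<bar> \<le> \<epsilon>" using ends[of 0] by simp
    moreover have "\<bar>g (real N) - g (- real N)\<bar> \<le> V"
    proof (cases "N = 0")
      case False
      then have "strict_mono_on {0..1} (\<lambda>i::nat. if i = 0 then - real N else real N)"
        by (auto simp: strict_mono_on_def)
      from sum_le_total_variation[OF this, of g] V show ?thesis
        by (simp add: order_trans[of "ereal _" _ "ereal V", simplified])
    qed (use V0 in auto)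
    ultimately show ?thesis by simp
  qed
  show ?thesis
    using main[of s t] main[of t s] st V0 e0
    by (cases s t rule: linorder_cases) (auto simp: abs_minus_commute)
qed

section \<open>The first periodic primitive\<close>

lemma has_integral_affine:
  fixes a b p q r :: real
  assumes "a \<le> b"
  shows "((\<lambda>t. p * (t - r) + q) has_integral
      p * ((b - r)\<^sup>2 - (a - r)\<^sup>2) / 2 + q * (b - a)) {a..b}" (is ?A)
    and "((\<lambda>t. (p * (t - r) + q)\<^sup>2) has_integral
      p\<^sup>2 * ((b - r) ^ 3 - (a - r) ^ 3) / 3 + p * q * ((b - r)\<^sup>2 - (a - r)\<^sup>2) + q\<^sup>2 * (b - a)) {a..b}" (is ?B)
proof -
  have "((\<lambda>t. p * (t - r) + q) has_integral
      (p * (b - r)\<^sup>2 / 2 + q * b) - (p * (a - r)\<^sup>2 / 2 + q * a)) {a..b}"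
    using assms by (intro fundamental_theorem_of_calculus)
      (auto simp flip: has_real_derivative_iff_has_vector_derivative intro!: derivative_eq_intros)
  moreover have "(p * (b - r)\<^sup>2 / 2 + q * b) - (p * (a - r)\<^sup>2 / 2 + q * a)
      = p * ((b - r)\<^sup>2 - (a - r)\<^sup>2) / 2 + q * (b - a)" by (simp add: field_simps)
  ultimately show ?A by (simp only:)
  have "((\<lambda>t. (p * (t - r) + q)\<^sup>2) has_integral
      (p\<^sup>2 * (b - r) ^ 3 / 3 + p * q * (b - r)\<^sup>2 + q\<^sup>2 * b)
      - (p\<^sup>2 * (a - r) ^ 3 / 3 + p * q * (a - r)\<^sup>2 + q\<^sup>2 * a)) {a..b}"
    using assms by (intro fundamental_theorem_of_calculus)
      (auto simp flip: has_real_derivative_iff_has_vector_derivative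
        intro!: derivative_eq_intros simp: power2_eq_square field_simps)
  moreover have "(p\<^sup>2 * (b - r) ^ 3 / 3 + p * q * (b - r)\<^sup>2 + q\<^sup>2 * b)
      - (p\<^sup>2 * (a - r) ^ 3 / 3 + p * q * (a - r)\<^sup>2 + q\<^sup>2 * a)
      = p\<^sup>2 * ((b - r) ^ 3 - (a - r) ^ 3) / 3 + p * q * ((b - r)\<^sup>2 - (a - r)\<^sup>2) + q\<^sup>2 * (b - a)"
    by (simp add: field_simps)
  ultimately show ?B by (simp only:)
qed

text \<open>The centred primitive on \<open>{0..1}\<close> of the indicator function of \<open>{x..y}\<close> minus its mean.\<close>

definition ramp :: "real \<Rightarrow> real \<Rightarrow> real \<Rightarrow> real" where
  "ramp x y t = max x (min y t) - x - (y - x) * (t - x) - (y - x) * (1 - (y - x)) / 2"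

lemma ramp_lipschitz:
  assumes "0 \<le> x" "x < y" "y \<le> 1"
  shows "\<bar>ramp x y v - ramp x y u\<bar> \<le> 2 * \<bar>v - u\<bar>"
proof -
  have "\<bar>max x (min y v) - max x (min y u)\<bar> \<le> \<bar>v - u\<bar>" by (auto simp: max_def min_def)
  moreover have "\<bar>(y - x) * (v - u)\<bar> \<le> 1 * \<bar>v - u\<bar>"
    unfolding abs_mult using assms by (intro mult_right_mono) auto
  moreover have "ramp x y v - ramp x y u = (max x (min y v) - max x (min y u)) - (y - x) * (v - u)"
    by (simp add: ramp_def algebra_simps)
  then have "\<bar>ramp x y v - ramp x y u\<bar> \<le> \<bar>max x (min y v) - max x (min y u)\<bar> + \<bar>(y - x) * (v - u)\<bar>"
    by (simp only: abs_triangle_ineq4)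
  ultimately show ?thesis by simp
qed

lemma ramp_has_real_derivative:
  assumes "x < y" "t \<noteq> x" "t \<noteq> y"
  shows "(ramp x y has_real_derivative (if t \<in> {x..y} then 1 else 0) - (y - x)) (at t)"
proof -
  consider "t < x" | "x < t" "t < y" | "y < t" using assms by linarith
  then show ?thesis
  proof cases
    case 1
    have "((\<lambda>t. - (y - x) * (t - x) - (y - x) * (1 - (y - x)) / 2) has_real_derivative
        (if t \<in> {x..y} then 1 else 0) - (y - x)) (at t)"
      using 1 assms by (auto intro!: derivative_eq_intros)
    then show ?thesis
      by (rule has_field_derivative_transform_within_open[of _ _ _ "{..<x}"])
        (use 1 assms in \<open>auto simp: ramp_def max_def min_def algebra_simps\<close>)
  next
    case 2
    have "((\<lambda>t. t - x - (y - x) * (t - x) - (y - x) * (1 - (y - x)) / 2) has_real_derivative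
        (if t \<in> {x..y} then 1 else 0) - (y - x)) (at t)"
      using 2 assms by (auto intro!: derivative_eq_intros)
    then show ?thesis
      by (rule has_field_derivative_transform_within_open[of _ _ _ "{x<..<y}"])
        (use 2 assms in \<open>auto simp: ramp_def max_def min_def algebra_simps\<close>)
  next
    case 3
    have "((\<lambda>t. y - x - (y - x) * (t - x) - (y - x) * (1 - (y - x)) / 2) has_real_derivative
        (if t \<in> {x..y} then 1 else 0) - (y - x)) (at t)"
      using 3 assms by (auto intro!: derivative_eq_intros)
    then show ?thesis
      by (rule has_field_derivative_transform_within_open[of _ _ _ "{y<..}"])
        (use 3 assms in \<open>auto simp: ramp_def max_def min_def algebra_simps\<close>)
  qed
qed

lemma continuous_on_ramp: "continuous_on S (ramp x y)"
  unfolding ramp_def [abs_def] by (intro continuous_intros)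

lemma ramp_0_eq_1:
  assumes "0 \<le> x" "x < y" "y \<le> 1"
  shows "ramp x y 0 = ramp x y 1"
  using assms by (simp add: ramp_def algebra_simps)

text \<open>With \<open>A = d * (1 - d) / 2\<close> the ramp rises linearly from \<open>- A\<close>
  at \<open>x\<close> to \<open>A\<close> at \<open>y\<close> and falls linearly back along the rest
  of the circle. Both arcs therefore have mean 0 and mean square \<open>A\<^sup>2 / 3\<close>. The
  computation uses three pieces because the falling arc crosses the point 0 = 1.\<close>

lemma integral_ramp:
  assumes xy: "0 \<le> x" "x < y" "y \<le> 1"
  shows "integral {0..1} (ramp x y) = 0"
    and "integral {0..1} (\<lambda>t. (ramp x y t)\<^sup>2) = ((y - x) * (1 - (y - x)))\<^sup>2 / 12"
proof -
  define d where "d = y - x"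
  define A where "A = d * (1 - d) / 2"
  have y: "y = x + d" by (simp add: d_def)
  have r1: "ramp x y t = - d * (t - x) + - A" if "t \<in> {0..x}" for t
    using that xy by (simp add: ramp_def d_def A_def algebra_simps)
  have r2: "ramp x y t = (1 - d) * (t - x) + - A" if "t \<in> {x..y}" for t
    using that xy by (simp add: ramp_def d_def A_def algebra_simps)
  have r3: "ramp x y t = - d * (t - y) + A" if "t \<in> {y..1}" for t
    using that xy by (simp add: ramp_def d_def A_def field_simps)
  have glue: "(f has_integral (I1 + I2 + I3)) {0..1}"
    if "(f has_integral I1) {0..x}" "(f has_integral I2) {x..y}" "(f has_integral I3) {y..1}"
    for f :: "real \<Rightarrow> real" and I1 I2 I3
    using has_integral_combine[OF _ _ has_integral_combine[OF _ _ that(1,2)] that(3)] xy by simp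
  have "(ramp x y has_integral (- d * ((x - x)\<^sup>2 - (0 - x)\<^sup>2) / 2 + - A * (x - 0))
      + ((1 - d) * ((y - x)\<^sup>2 - (x - x)\<^sup>2) / 2 + - A * (y - x))
      + (- d * ((1 - y)\<^sup>2 - (y - y)\<^sup>2) / 2 + A * (1 - y))) {0..1}"
    by (rule glue; rule has_integral_eq[rotated], rule has_integral_affine) (use xy r1 r2 r3 in auto)
  moreover have "(- d * ((x - x)\<^sup>2 - (0 - x)\<^sup>2) / 2 + - A * (x - 0))
      + ((1 - d) * ((y - x)\<^sup>2 - (x - x)\<^sup>2) / 2 + - A * (y - x))
      + (- d * ((1 - y)\<^sup>2 - (y - y)\<^sup>2) / 2 + A * (1 - y)) = 0"
    unfolding A_def y by (simp add: field_simps power2_eq_square)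
  ultimately show "integral {0..1} (ramp x y) = 0" by (simp only: integral_unique)
  have "((\<lambda>t. (ramp x y t)\<^sup>2) has_integral
      ((- d)\<^sup>2 * ((x - x) ^ 3 - (0 - x) ^ 3) / 3 + - d * - A * ((x - x)\<^sup>2 - (0 - x)\<^sup>2) + (- A)\<^sup>2 * (x - 0))
      + ((1 - d)\<^sup>2 * ((y - x) ^ 3 - (x - x) ^ 3) / 3 + (1 - d) * - A * ((y - x)\<^sup>2 - (x - x)\<^sup>2) + (- A)\<^sup>2 * (y - x))
      + ((- d)\<^sup>2 * ((1 - y) ^ 3 - (y - y) ^ 3) / 3 + - d * A * ((1 - y)\<^sup>2 - (y - y)\<^sup>2) + A\<^sup>2 * (1 - y))) {0..1}"
    by (rule glue; rule has_integral_eq[rotated], rule has_integral_affine) (use xy r1 r2 r3 in auto)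
  moreover have "((- d)\<^sup>2 * ((x - x) ^ 3 - (0 - x) ^ 3) / 3 + - d * - A * ((x - x)\<^sup>2 - (0 - x)\<^sup>2) + (- A)\<^sup>2 * (x - 0))
      + ((1 - d)\<^sup>2 * ((y - x) ^ 3 - (x - x) ^ 3) / 3 + (1 - d) * - A * ((y - x)\<^sup>2 - (x - x)\<^sup>2) + (- A)\<^sup>2 * (y - x))
      + ((- d)\<^sup>2 * ((1 - y) ^ 3 - (y - y) ^ 3) / 3 + - d * A * ((1 - y)\<^sup>2 - (y - y)\<^sup>2) + A\<^sup>2 * (1 - y))
      = (d * (1 - d))\<^sup>2 / 12"
    unfolding A_def y by (simp add: field_simps power2_eq_square power3_eq_cube)
  ultimately show "integral {0..1} (\<lambda>t. (ramp x y t)\<^sup>2) = ((y - x) * (1 - (y - x)))\<^sup>2 / 12"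
    by (simp only: integral_unique d_def)
qed

section \<open>Integration by parts against periodic kernels\<close>

lemma continuous_derivative_imp_lipschitz:
  fixes F F' :: "real \<Rightarrow> real"
  assumes deriv: "\<And>x. x \<in> {a..b} \<Longrightarrow> (F has_real_derivative F' x) (at x within {a..b})"
    and cont: "continuous_on {a..b} F'"
  obtains L where "0 \<le> L" "\<And>u v. u \<in> {a..b} \<Longrightarrow> v \<in> {a..b} \<Longrightarrow> \<bar>F v - F u\<bar> \<le> L * \<bar>v - u\<bar>"
proof -
  have "bounded (F' ` {a..b})" using cont by (intro compact_imp_bounded compact_continuous_image) auto
  then have "\<exists>B. \<forall>x\<in>{a..b}. \<bar>F' x\<bar> \<le> B" by (auto simp: bounded_iff)
  then obtain B where B: "\<And>x. x \<in> {a..b} \<Longrightarrow> \<bar>F' x\<bar> \<le> B" by blast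
  have "norm (F v - F u) \<le> \<bar>B\<bar> * norm (v - u)" if "u \<in> {a..b}" "v \<in> {a..b}" for u v
    by (rule field_differentiable_bound[OF convex_real_interval(5) deriv])
      (use B that in \<open>force+\<close>)
  then show thesis by (intro that[of "\<bar>B\<bar>"]) auto
qed

lemma absolutely_continuous_fun_on_C1:
  fixes F F' :: "real \<Rightarrow> real"
  assumes deriv: "\<And>x. (F has_real_derivative F' x) (at x)" and cont: "continuous_on UNIV F'"
  shows "absolutely_continuous_fun_on {a..b} F"
proof -
  have "(F has_real_derivative F' x) (at x within {a..b})" for x
    using deriv by (rule has_field_derivative_at_within)
  moreover have "continuous_on {a..b} F'" using cont by (rule continuous_on_subset) simp
  ultimately obtain L where L: "0 \<le> L"
    "\<And>u v. u \<in> {a..b} \<Longrightarrow> v \<in> {a..b} \<Longrightarrow> \<bar>F v - F u\<bar> \<le> L * \<bar>v - u\<bar>"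
    using continuous_derivative_imp_lipschitz[of a b F F'] by blast
  show ?thesis
  proof (rule absolutely_continuous_fun_on_increment_bound[OF absolutely_continuous_fun_on_id, of 0 L])
    show "\<bar>F v - F u\<bar> \<le> 0 * \<bar>v - u\<bar> + L * (v - u)" if "u \<in> {a..b}" "v \<in> {a..b}" "u < v" for u v
      using L(2)[OF that(1,2)] that(3) by simp
  qed (use L in auto)
qed

lemma derivatives_tendsto_0_at_bot:
  fixes E :: "nat \<Rightarrow> real \<Rightarrow> real" and g :: "real \<Rightarrow> real"
  assumes E0: "(E 0 \<longlongrightarrow> c) at_bot"
    and der: "\<And>i x. i < m \<Longrightarrow> (E i has_real_derivative E (Suc i) x) (at x)"
    and int: "\<And>u v. u \<le> v \<Longrightarrow> (g has_integral (E m v - E m u)) {u..v}"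
    and Cauchy: "\<And>e. 0 < e \<Longrightarrow> \<exists>X. \<forall>a>X. \<forall>b>a. \<bar>g (- b) - g (- a)\<bar> \<le> e"
  shows "(g \<longlongrightarrow> 0) at_bot"
    and "\<And>i. 1 \<le> i \<Longrightarrow> i \<le> m \<Longrightarrow> (E i \<longlongrightarrow> 0) at_bot"
proof -
  \<comment> \<open>The sign makes the reflected functions a chain of derivatives again, so the
    statement at plus infinity applies to them.\<close>
  define E' where "E' i x = (- 1) ^ i * E i (- x)" for i x
  define g' where "g' x = (- 1) ^ Suc m * g (- x)" for x
  have 1: "(E' 0 \<longlongrightarrow> c) at_top"
    using E0 by (simp add: E'_def [abs_def] filterlim_at_bot_mirror)
  have 2: "(E' i has_real_derivative E' (Suc i) x) (at x)" if "i < m" for i x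
  proof -
    have "((\<lambda>x. E i (- x)) has_real_derivative E (Suc i) (- x) * - 1) (at x)"
      by (rule DERIV_chain2[OF der[OF that]]) (auto intro!: derivative_eq_intros)
    from DERIV_cmult[OF this, of "(- 1) ^ i"] show ?thesis
      by (simp add: E'_def [abs_def])
  qed
  have 3: "(g' has_integral (E' m v - E' m u)) {u..v}" if "u \<le> v" for u v
  proof -
    have "((\<lambda>x. g (- x)) has_integral (E m (- u) - E m (- v))) {u..v}"
      using has_integral_reflect_lemma_real[OF int[of "- v" "- u"]] that by simp
    from has_integral_mult_right[OF this, of "(- 1) ^ Suc m"] show ?thesis
      by (simp add: E'_def g'_def [abs_def] algebra_simps)
  qed
  have "\<bar>g' b - g' a\<bar> = \<bar>g (- b) - g (- a)\<bar>" for a b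
    by (simp add: g'_def abs_mult power_abs flip: right_diff_distrib)
  then have 4: "\<exists>X. \<forall>a>X. \<forall>b>a. \<bar>g' b - g' a\<bar> \<le> e" if "0 < e" for e
    using Cauchy[OF that] by simp
  have sign: "(h \<longlongrightarrow> 0) at_bot" if "((\<lambda>x. (- 1) ^ n * h (- x)) \<longlongrightarrow> 0) at_top"
    for h :: "real \<Rightarrow> real" and n :: nat
  proof -
    have "((\<lambda>x. (- 1) ^ n * ((- 1) ^ n * h (- x))) \<longlongrightarrow> (- 1) ^ n * 0) at_top"
      by (intro tendsto_mult that tendsto_const)
    moreover have "(- 1) ^ n * ((- 1) ^ n * z) = z" for z :: real
      by (simp flip: mult.assoc power_mult_distrib)
    ultimately show ?thesis by (simp add: filterlim_at_bot_mirror)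
  qed
  show "(g \<longlongrightarrow> 0) at_bot"
    using derivatives_tendsto_0_at_top(1)[OF 1 2 3 4] by (intro sign[of "Suc m"]) (simp add: g'_def [abs_def])
  show "(E i \<longlongrightarrow> 0) at_bot" if "1 \<le> i" "i \<le> m" for i
    using derivatives_tendsto_0_at_top(2)[OF 1 2 3 4 that] by (intro sign[of i]) (simp add: E'_def [abs_def])
qed

text \<open>The integral of \<open>u\<close> against the 1-periodic extension of \<open>\<kappa>\<close> over \<open>{- N..N}\<close>.\<close>

definition periodic_pairing :: "nat \<Rightarrow> (real \<Rightarrow> real) \<Rightarrow> (real \<Rightarrow> real) \<Rightarrow> real" where
  "periodic_pairing N u \<kappa> = (\<Sum>i<2 * N.
    integral {real i - real N..real i - real N + 1} (\<lambda>t. u t * \<kappa> (t - (real i - real N))))"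

text \<open>Integrate by parts on each unit cell. Because \<open>H 0 = H 1\<close>, the boundary
  terms telescope to \<open>H 0 * (u N - u (- N))\<close>. The finite set \<open>Z0\<close> admits
  the corners of the ramp, and the integrability claim serves the last stage, where \<open>v\<close>
  is only a version of a derivative.\<close>

lemma periodic_pairing_by_parts:
  fixes u v H H' :: "real \<Rightarrow> real"
  assumes ac: "\<And>a b. absolutely_continuous_fun_on {a..b} u"
    and Z: "negligible Z" and deriv: "\<And>x. x \<notin> Z \<Longrightarrow> (u has_real_derivative v x) (at x)"
    and L: "0 \<le> L" and lip: "\<And>s t. s \<in> {0..1} \<Longrightarrow> t \<in> {0..1} \<Longrightarrow> \<bar>H t - H s\<bar> \<le> L * \<bar>t - s\<bar>"
    and Z0: "finite Z0"
    and H': "\<And>t. t \<in> {0..1} - Z0 \<Longrightarrow> (H has_real_derivative H' t) (at t within {0..1})"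
    and per: "H 0 = H 1"
    and int: "\<And>c. (\<lambda>t. u t * H' (t - c)) integrable_on {c..c + 1}"
  shows "(\<lambda>t. v t * H (t - c)) integrable_on {c..c + 1}"
    and "\<lbrakk>(u \<longlongrightarrow> 0) at_top; (u \<longlongrightarrow> 0) at_bot\<rbrakk> \<Longrightarrow>
      (\<lambda>N. periodic_pairing N u H' + periodic_pairing N v H) \<longlonglongrightarrow> 0"
proof -
  have parts: "((\<lambda>t. v t * H (t - c)) has_integral (u (c + 1) * H 1 - u c * H 0
      - integral {c..c + 1} (\<lambda>t. u t * H' (t - c)))) {c..c + 1}" for c
  proof -
    have "((\<lambda>t. v t * H (t - c)) has_integral (u (c + 1) * H (c + 1 - c) - u c * H (c - c)
        - integral {c..c + 1} (\<lambda>t. u t * H' (t - c)))) {c..c + 1}"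
    proof (rule has_integral_by_parts_absolutely_continuous[OF _ ac _ _ L])
      show "negligible (Z \<union> (\<lambda>t. t + c) ` Z0)"
        using Z0 by (intro negligible_Un[OF Z] negligible_finite) auto
      show "(u has_real_derivative v x) (at x within {c..c + 1})"
        if "x \<in> {c..c + 1} - (Z \<union> (\<lambda>t. t + c) ` Z0)" for x
        using deriv[of x] that by (auto intro: has_field_derivative_at_within)
      show "\<bar>H (t - c) - H (s - c)\<bar> \<le> L * \<bar>t - s\<bar>"
        if "s \<in> {c..c + 1}" "t \<in> {c..c + 1}" for s t
        using lip[of "s - c" "t - c"] that by auto
      show "((\<lambda>t. H (t - c)) has_real_derivative H' (x - c)) (at x within {c..c + 1})"
        if "x \<in> {c..c + 1} - (Z \<union> (\<lambda>t. t + c) ` Z0)" for x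
      proof -
        have "x - c \<notin> Z0" using that by force
        moreover have "(\<lambda>t. t - c) ` {c..c + 1} = {0..1}"
          by (auto simp: image_iff intro!: bexI[of _ "_ + c"])
        ultimately have "(H has_real_derivative H' (x - c)) (at (x - c) within (\<lambda>t. t - c) ` {c..c + 1})"
          using H'[of "x - c"] that by auto
        moreover have "((\<lambda>t. t - c) has_real_derivative 1) (at x within {c..c + 1})"
          by (auto intro!: derivative_eq_intros)
        ultimately have "(H \<circ> (\<lambda>t. t - c) has_real_derivative H' (x - c) * 1) (at x within {c..c + 1})"
          by (rule DERIV_image_chain)
        then show ?thesis by (simp add: o_def)
      qed
    qed (use int in auto)
    then show ?thesis by simp
  qed
  then show "(\<lambda>t. v t * H (t - c)) integrable_on {c..c + 1}" by blast
  assume lim: "(u \<longlongrightarrow> 0) at_top" "(u \<longlongrightarrow> 0) at_bot"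
  have tele: "(\<Sum>i<n. u (real i - real N + 1) * H 1 - u (real i - real N) * H 0)
      = H 0 * (u (real n - real N) - u (- real N))" for n N
    by (induction n) (auto simp: per algebra_simps)
  have eq: "periodic_pairing N u H' + periodic_pairing N v H = H 0 * (u (real N) - u (- real N))" for N
    unfolding periodic_pairing_def integral_unique[OF parts]
    using tele[where n = "2 * N" and N = N] by (simp add: sum_subtractf)
  have "(\<lambda>N. H 0 * (u (real N) - u (- real N))) \<longlonglongrightarrow> H 0 * (0 - 0)"
    by (intro tendsto_intros filterlim_compose[OF lim(1)] filterlim_compose[OF lim(2)]) real_asymp+
  then show "(\<lambda>N. periodic_pairing N u H' + periodic_pairing N v H) \<longlonglongrightarrow> 0"
    by (simp add: eq)
qed

text \<open>Shifting all cells to \<open>{0..1}\<close> turns the pairing into one integral of the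
  periodized \<open>g\<close> against \<open>\<kappa>\<close>. The 4 is a product of two halves: one
  from the oscillation of the periodization, one from centring it.\<close>

lemma abs_periodic_pairing_le:
  fixes g \<kappa> :: "real \<Rightarrow> real"
  assumes V: "total_variation g \<le> ereal V"
    and ends: "\<And>s. s \<in> {0..1} \<Longrightarrow> \<bar>g (s + real N) - g (s - real N)\<bar> \<le> \<epsilon>"
    and cont: "continuous_on {0..1} \<kappa>" and mean: "integral {0..1} \<kappa> = 0"
    and int: "\<And>c. (\<lambda>t. g t * \<kappa> (t - c)) integrable_on {c..c + 1}"
  shows "\<bar>periodic_pairing N g \<kappa>\<bar> \<le> (V + \<epsilon>) / 4 * integral {0..1} (\<lambda>s. \<bar>\<kappa> s\<bar>)"
proof -
  have "((\<lambda>s. g (s + c) * \<kappa> s) has_integral integral {c..c + 1} (\<lambda>t. g t * \<kappa> (t - c))) {0..1}" for c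
    using has_integral_shift_real_ivl[OF integrable_integral[OF int[of c]], of c] by simp
  then have "((\<lambda>s. \<Sum>i<2 * N. g (s + (real i - real N)) * \<kappa> s) has_integral periodic_pairing N g \<kappa>) {0..1}"
    unfolding periodic_pairing_def by (intro has_integral_sum) auto
  then have "((\<lambda>s. (\<Sum>i<2 * N. g (s + (real i - real N))) * \<kappa> s) has_integral periodic_pairing N g \<kappa>) {0..1}"
    by (simp add: sum_distrib_right)
  from abs_integral_mult_oscillation_le[OF periodization_oscillation_le[OF V ends] cont mean this]
  show ?thesis by simp
qed

text \<open>The kernel of index \<open>j\<close> is the one to be paired with the derivative of
  order \<open>j\<close> of the density. Index 0 has jumps, whereas the facts about
  \<open>centred_primitive\<close> concern continuous functions; so its primitive is entered
  explicitly as \<open>ramp\<close>, and iteration starts there.\<close>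

definition gap_kernel :: "real \<Rightarrow> real \<Rightarrow> nat \<Rightarrow> real \<Rightarrow> real" where
  "gap_kernel x y j = (case j of
      0 \<Rightarrow> (\<lambda>t. (if t \<in> {x..y} then 1 else 0) - (y - x))
    | Suc n \<Rightarrow> (centred_primitive ^^ n) (ramp x y))"

lemma gap_kernel_Suc:
  assumes xy: "0 \<le> x" "x < y" "y \<le> 1"
  shows "continuous_on {0..1} (gap_kernel x y (Suc j))"
    and "integral {0..1} (gap_kernel x y (Suc j)) = 0"
    and "gap_kernel x y (Suc j) 0 = gap_kernel x y (Suc j) 1"
    and "\<And>t. t \<in> {0..1} - {x, y} \<Longrightarrow>
      (gap_kernel x y (Suc j) has_real_derivative gap_kernel x y j t) (at t within {0..1})"
    and "\<exists>L\<ge>0. \<forall>s\<in>{0..1}. \<forall>t\<in>{0..1}. \<bar>gap_kernel x y (Suc j) t - gap_kernel x y (Suc j) s\<bar> \<le> L * \<bar>t - s\<bar>"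
    and "integral {0..1} (\<lambda>t. \<bar>gap_kernel x y (Suc j) t\<bar>) \<le> (y - x) * (1 - (y - x)) * 2 / 6 ^ Suc j"
proof -
  define d where "d = y - x"
  have k: "gap_kernel x y (Suc j) = (centred_primitive ^^ j) (ramp x y)" for j
    by (simp add: gap_kernel_def)
  note it = centred_primitive_iterate[OF continuous_on_ramp integral_ramp(1)[OF xy]]
  show cont: "continuous_on {0..1} (gap_kernel x y (Suc j))" for j unfolding k by (rule it)
  show int: "integral {0..1} (gap_kernel x y (Suc j)) = 0" for j unfolding k by (rule it)
  have "gap_kernel x y (Suc j) 0 = gap_kernel x y (Suc j) 1 \<and>
    (\<forall>t \<in> {0..1} - {x, y}. (gap_kernel x y (Suc j) has_real_derivative gap_kernel x y j t) (at t within {0..1})) \<and>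
    (\<exists>L\<ge>0. \<forall>s\<in>{0..1}. \<forall>t\<in>{0..1}. \<bar>gap_kernel x y (Suc j) t - gap_kernel x y (Suc j) s\<bar> \<le> L * \<bar>t - s\<bar>)"
  proof (cases j)
    case 0
    have "(ramp x y has_real_derivative gap_kernel x y 0 t) (at t within {0..1})" if "t \<notin> {x, y}" for t
      using ramp_has_real_derivative[OF xy(2), of t] that
      by (auto simp: gap_kernel_def intro: has_field_derivative_at_within)
    then show ?thesis
      using ramp_lipschitz[OF xy] ramp_0_eq_1[OF xy] 0 by (auto simp: k intro!: exI[of _ 2])
  next
    case (Suc n)
    note c = centred_primitive[OF cont[of n]]
    have ks: "gap_kernel x y (Suc (Suc n)) = centred_primitive (gap_kernel x y (Suc n))" by (simp add: k)
    obtain L where "0 \<le> L" "\<And>s t. s \<in> {0..1} \<Longrightarrow> t \<in> {0..1} \<Longrightarrow>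
        \<bar>centred_primitive (gap_kernel x y (Suc n)) t - centred_primitive (gap_kernel x y (Suc n)) s\<bar> \<le> L * \<bar>t - s\<bar>"
      using continuous_derivative_imp_lipschitz[OF c(1) cont] by blast
    then show ?thesis
      using c(1,4) int[of n] unfolding Suc ks by auto
  qed
  then show "gap_kernel x y (Suc j) 0 = gap_kernel x y (Suc j) 1"
    and "\<And>t. t \<in> {0..1} - {x, y} \<Longrightarrow>
      (gap_kernel x y (Suc j) has_real_derivative gap_kernel x y j t) (at t within {0..1})"
    and "\<exists>L\<ge>0. \<forall>s\<in>{0..1}. \<forall>t\<in>{0..1}. \<bar>gap_kernel x y (Suc j) t - gap_kernel x y (Suc j) s\<bar> \<le> L * \<bar>t - s\<bar>"
    by blast+
  have d: "0 \<le> d * (1 - d)" using xy by (auto simp: d_def intro!: mult_nonneg_nonneg)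
  show "integral {0..1} (\<lambda>t. \<bar>gap_kernel x y (Suc j) t\<bar>) \<le> (y - x) * (1 - (y - x)) * 2 / 6 ^ Suc j"
  proof (rule power2_le_imp_le)
    have "(integral {0..1} (\<lambda>t. \<bar>gap_kernel x y (Suc j) t\<bar>))\<^sup>2 \<le> integral {0..1} (\<lambda>t. (gap_kernel x y (Suc j) t)\<^sup>2)"
      by (rule integral_abs_squared_le[OF cont])
    also have "\<dots> \<le> (d * (1 - d))\<^sup>2 / 12 / 36 ^ j"
      using it(3)[of j] integral_ramp(2)[OF xy] by (simp add: k d_def field_simps)
    \<comment> \<open>Lowering 12 to 9 gives a perfect square, and the resulting factor 1/3 = 2/6
      supplies the missing power of 6.\<close>
    also have "\<dots> \<le> (d * (1 - d))\<^sup>2 / 9 / 36 ^ j"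
      by (intro divide_right_mono divide_left_mono) auto
    also have "\<dots> = (d * (1 - d) * 2 / 6 ^ Suc j)\<^sup>2"
    proof -
      have "(36::real) ^ j = (6 ^ j)\<^sup>2" by (simp add: power2_eq_square flip: power_mult_distrib)
      then show ?thesis by (simp add: power_divide power_mult_distrib)
    qed
    finally show "(integral {0..1} (\<lambda>t. \<bar>gap_kernel x y (Suc j) t\<bar>))\<^sup>2 \<le> ((y - x) * (1 - (y - x)) * 2 / 6 ^ Suc j)\<^sup>2"
      by (simp add: d_def)
    show "0 \<le> (y - x) * (1 - (y - x)) * 2 / 6 ^ Suc j" using d by (simp add: d_def)
  qed
qed

text \<open>The analytic core, free of probability: \<open>F\<close> stands for the distribution
  function and \<open>E\<close> for the error to be estimated. \<open>E\<close> is the limit of the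
  pairings of index 0, whose absolute values asymptotically agree with those of index
  \<open>k\<close>, and the latter are bounded by the variation of \<open>g\<close>.\<close>

lemma periodized_increment_bound:
  fixes F f g :: "real \<Rightarrow> real"
  assumes F: "\<And>x. (F has_real_derivative f x) (at x)"
    and Flim: "(F \<longlongrightarrow> c1) at_top" "(F \<longlongrightarrow> c0) at_bot"
    and k: "1 \<le> k" and tac: "times_absolutely_continuous k f" and ver: "version_of_deriv k f g"
    and V: "total_variation g = ereal V"
    and xy: "0 \<le> x" "x < y" "y \<le> 1"
    and E: "(\<lambda>N. \<Sum>i<2 * N. F (real i - real N + y) - F (real i - real N + x)
        - (y - x) * (F (real i - real N + 1) - F (real i - real N))) \<longlonglongrightarrow> E"
  shows "\<bar>E\<bar> \<le> (y - x) * (1 - (y - x)) * (V / (2 * 6 ^ k))"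
proof -
  \<comment> \<open>Taking the given version \<open>g\<close> as the entry of index \<open>k\<close>
    lets one argument serve all \<open>k\<close> integrations by parts, the almost everywhere one
    included.\<close>
  define D where "D j = (if j < k then (deriv ^^ j) f else g)" for j
  have D0: "D 0 = f" and Dk: "D k = g" using k by (auto simp: D_def)
  have tac': "continuously_differentiable (k - 1) f" "locally_absolutely_continuous ((deriv ^^ (k - 1)) f)"
    using tac by (auto simp: times_absolutely_continuous_def)
  have der: "(D j has_real_derivative D (Suc j) x) (at x)" if "Suc j < k" for j x
  proof -
    have "(deriv ^^ j) f differentiable_on UNIV"
      using tac'(1) that by (auto simp: continuously_differentiable_def)
    then have "(deriv ^^ j) f differentiable (at x)" by (auto simp: differentiable_on_def)
    then have "((deriv ^^ j) f has_real_derivative deriv ((deriv ^^ j) f) x) (at x)"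
      by (simp add: DERIV_deriv_iff_real_differentiable)
    then show ?thesis using that by (simp add: D_def)
  qed
  have contD: "continuous_on UNIV (D j)" if "j < k" for j
  proof (cases "Suc j = k")
    case True
    then have "j = k - 1" by simp
    then show ?thesis using tac'(1) that by (simp add: D_def continuously_differentiable_def)
  next
    case False
    then have "Suc j < k" using that by simp
    then show ?thesis
      using DERIV_isCont[OF der] by (intro continuous_at_imp_continuous_on) blast
  qed
  have acD: "absolutely_continuous_fun_on {a..b} (D j)" if "j < k" for a b j
  proof (cases "Suc j = k")
    case True
    then have "j = k - 1" by simp
    then show ?thesis using tac'(2) that by (simp add: D_def locally_absolutely_continuous_def)
  next
    case False
    then have "Suc j < k" using that by simp
    then show ?thesis by (intro absolutely_continuous_fun_on_C1[OF der contD])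
  qed
  define Z where "Z = {x. \<not> (D (k - 1) has_real_derivative g x) (at x)}"
  have "AE x in lebesgue. (D (k - 1) has_real_derivative g x) (at x)"
    using ver k by (simp add: version_of_deriv_def D_def)
  then have Z: "negligible Z"
    unfolding Z_def negligible_iff_null_sets completion.AE_iff_null_sets by simp
  have derZ: "(D j has_real_derivative D (Suc j) x) (at x)" if "j < k" "x \<notin> Z" for j x
  proof (cases "Suc j = k")
    case True
    then have "j = k - 1" by simp
    then show ?thesis using that True Dk by (simp add: Z_def)
  qed (use der that in auto)
  have int: "(g has_integral (D (k - 1) v - D (k - 1) u)) {u..v}" if "u \<le> v" for u v
    using derZ[of "k - 1"] k Dk
    by (intro fundamental_theorem_of_calculus_absolutely_continuous[OF that acD Z])
      (auto intro: has_field_derivative_at_within)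
  \<comment> \<open>The chain is extended downwards by \<open>F\<close>, because convergence at both
    ends is known for \<open>F\<close> and the decay of \<open>f\<close> itself has to be derived
    from it.\<close>
  define Q where "Q j = (case j of 0 \<Rightarrow> F | Suc n \<Rightarrow> D n)" for j
  have Q: "(Q j has_real_derivative Q (Suc j) x) (at x)" if "j < k" for j x
    using that F der D0 by (cases j) (auto simp: Q_def)
  have Qk: "Q k = D (k - 1)" using k by (cases k) (auto simp: Q_def)
  have tv: "total_variation g < \<infinity>" using V by simp
  then have tv': "total_variation (\<lambda>x. g (- x)) < \<infinity>"
    using total_variation_reflect_le[of g] by (rule order_le_less_trans[rotated])
  note C = finite_total_variation_Cauchy_at_top[OF tv] finite_total_variation_Cauchy_at_top[OF tv']
  have top: "(Q 0 \<longlongrightarrow> c1) at_top" and bot: "(Q 0 \<longlongrightarrow> c0) at_bot"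
    using Flim by (auto simp: Q_def)
  have int': "(g has_integral (Q k v - Q k u)) {u..v}" if "u \<le> v" for u v
    unfolding Qk by (rule int[OF that])
  note lim_top = derivatives_tendsto_0_at_top[OF top Q int' C(1)]
  note lim_bot = derivatives_tendsto_0_at_bot[OF bot Q int' C(2)]
  have Dlim: "(D j \<longlongrightarrow> 0) at_top" "(D j \<longlongrightarrow> 0) at_bot" if "j < k" for j
    using lim_top(2)[of "Suc j"] lim_bot(2)[of "Suc j"] that by (simp_all add: Q_def)
  \<comment> \<open>Thus the pairing of index 0 over the window is exactly the sum whose limit is
    \<open>E\<close>.\<close>
  have intg0: "((\<lambda>t. f t * gap_kernel x y 0 (t - c)) has_integral
      (F (c + y) - F (c + x) - (y - x) * (F (c + 1) - F c))) {c..c + 1}" for c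
  proof -
    have ftc: "(f has_integral (F b - F a)) {a..b}" if "a \<le> b" for a b
      using that F by (intro fundamental_theorem_of_calculus)
        (auto simp flip: has_real_derivative_iff_has_vector_derivative intro: has_field_derivative_at_within)
    have "((\<lambda>t. if t \<in> {c + x..c + y} then f t else 0) has_integral (F (c + y) - F (c + x))) {c..c + 1}"
      using ftc[of "c + x" "c + y"] xy by (subst has_integral_restrict) auto
    from has_integral_diff[OF this has_integral_mult_right[OF ftc[of c "c + 1"], of "y - x"]]
    show ?thesis
      by (rule has_integral_eq[rotated]) (auto simp: gap_kernel_def algebra_simps)
  qed
  have step: "(\<forall>c. (\<lambda>t. D (Suc j) t * gap_kernel x y (Suc j) (t - c)) integrable_on {c..c + 1}) \<and>
    (\<lambda>N. periodic_pairing N (D j) (gap_kernel x y j) + periodic_pairing N (D (Suc j)) (gap_kernel x y (Suc j)))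
      \<longlonglongrightarrow> 0" if "j < k" for j
  proof -
    obtain L where L: "0 \<le> L" "\<And>s t. s \<in> {0..1} \<Longrightarrow> t \<in> {0..1} \<Longrightarrow>
        \<bar>gap_kernel x y (Suc j) t - gap_kernel x y (Suc j) s\<bar> \<le> L * \<bar>t - s\<bar>"
      using gap_kernel_Suc(5)[OF xy] by blast
    have "(\<lambda>t. D j t * gap_kernel x y j (t - c)) integrable_on {c..c + 1}" for c
    proof (cases j)
      case 0
      then show ?thesis using intg0[of c] D0 by auto
    next
      case (Suc n)
      have "continuous_on {c..c + 1} (\<lambda>t. gap_kernel x y (Suc n) (t - c))"
        by (rule continuous_on_compose2[OF gap_kernel_Suc(1)[OF xy]]) (auto intro!: continuous_intros)
      then show ?thesis unfolding Suc
        using contD[OF that] Suc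
        by (intro integrable_continuous_real continuous_intros) (auto intro: continuous_on_subset)
    qed
    from periodic_pairing_by_parts[where ?Z0.0 = "{x, y}", OF acD[OF that] Z derZ[OF that] L _ gap_kernel_Suc(4)[OF xy]
        gap_kernel_Suc(3)[OF xy] this] Dlim[OF that]
    show ?thesis by simp
  qed
  define a where "a j N = periodic_pairing N (D j) (gap_kernel x y j)" for j N
  \<comment> \<open>Each integration by parts changes the sign, so consecutive pairings add up to
    something that tends to 0; absolute values avoid tracking the sign.\<close>
  have "(\<lambda>N. \<bar>a 0 N\<bar> - \<bar>a j N\<bar>) \<longlonglongrightarrow> 0" if "j \<le> k" for j
    using that
  proof (induction j)
    case (Suc j)
    have "(\<lambda>N. a j N + a (Suc j) N) \<longlonglongrightarrow> 0" using step[of j] Suc.prems by (simp add: a_def)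
    then have "(\<lambda>N. \<bar>a j N\<bar> - \<bar>a (Suc j) N\<bar>) \<longlonglongrightarrow> 0"
      by (rule Lim_null_comparison[rotated, OF tendsto_rabs_zero]) (auto intro!: always_eventually)
    from tendsto_add[OF Suc.IH this] Suc.prems show ?case by simp
  qed simp
  then have diff: "(\<lambda>N. \<bar>a 0 N\<bar> - \<bar>a k N\<bar>) \<longlonglongrightarrow> 0" by simp
  have a0: "a 0 \<longlonglongrightarrow> E"
    using E unfolding a_def periodic_pairing_def D0 integral_unique[OF intg0] by simp
  obtain n where n: "k = Suc n" using k by (cases k) auto
  define I where "I = integral {0..1} (\<lambda>t. \<bar>gap_kernel x y k t\<bar>)"
  have I: "I \<le> (y - x) * (1 - (y - x)) * 2 / 6 ^ k"
    using gap_kernel_Suc(6)[OF xy, of n] by (simp add: I_def n)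
  have I0: "0 \<le> I" unfolding I_def n
    by (intro Henstock_Kurzweil_Integration.integral_nonneg integrable_continuous_real
        continuous_intros gap_kernel_Suc(1)[OF xy]) simp
  have ak: "(\<lambda>N. \<bar>a k N\<bar>) \<longlonglongrightarrow> \<bar>E\<bar>"
    using tendsto_diff[OF tendsto_rabs[OF a0] diff] by simp
  \<comment> \<open>Here \<open>\<epsilon>\<close> bounds the end terms
    \<open>g (s + N) - g (s - N)\<close>, which are small for large \<open>N\<close> since
    \<open>g\<close> tends to 0 at both ends. Afterwards \<open>\<epsilon>\<close> tends to
    0.\<close>
  have bound: "\<bar>E\<bar> \<le> (V + \<epsilon>) / 4 * I" if "0 < \<epsilon>" for \<epsilon>
  proof (rule tendsto_upperbound[OF ak])
    have "eventually (\<lambda>t. \<bar>g t\<bar> < \<epsilon> / 2) at_top" "eventually (\<lambda>t. \<bar>g t\<bar> < \<epsilon> / 2) at_bot"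
      using tendstoD[OF lim_top(1), of "\<epsilon> / 2"] tendstoD[OF lim_bot(1), of "\<epsilon> / 2"] that
      by (simp_all add: dist_real_def)
    then obtain X X' where X: "\<And>t. t \<ge> X \<Longrightarrow> \<bar>g t\<bar> < \<epsilon> / 2" "\<And>t. t \<le> X' \<Longrightarrow> \<bar>g t\<bar> < \<epsilon> / 2"
      unfolding eventually_at_top_linorder eventually_at_bot_linorder by blast
    have "\<bar>a k N\<bar> \<le> (V + \<epsilon>) / 4 * I" if N: "real N \<ge> \<bar>X\<bar> + \<bar>X'\<bar> + 1" for N
      unfolding a_def I_def Dk
    proof (rule abs_periodic_pairing_le)
      show "\<bar>g (s + real N) - g (s - real N)\<bar> \<le> \<epsilon>" if "s \<in> {0..1}" for s
      proof -
        have "X \<le> s + real N" "s - real N \<le> X'" using that N by auto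
        from X(1)[OF this(1)] X(2)[OF this(2)] show ?thesis by linarith
      qed
      show "(\<lambda>t. g t * gap_kernel x y k (t - c)) integrable_on {c..c + 1}" for c
        using step[of n] by (simp add: n flip: Dk)
    qed (use V gap_kernel_Suc[OF xy, of n] in \<open>auto simp: n\<close>)
    moreover have "eventually (\<lambda>N. real N \<ge> \<bar>X\<bar> + \<bar>X'\<bar> + 1) sequentially" by real_asymp
    ultimately show "eventually (\<lambda>N. \<bar>a k N\<bar> \<le> (V + \<epsilon>) / 4 * I) sequentially"
      by (auto elim: eventually_mono)
  qed simp
  have "((\<lambda>\<epsilon>. (V + \<epsilon>) / 4 * I) \<longlongrightarrow> (V + 0) / 4 * I) (at_right 0)"
    by (intro tendsto_intros) simp
  moreover have "eventually (\<lambda>\<epsilon>. \<bar>E\<bar> \<le> (V + \<epsilon>) / 4 * I) (at_right 0)"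
    by (rule eventually_at_rightI[of 0 1]) (simp_all only: bound greaterThanLessThan_iff zero_less_one)
  ultimately have "\<bar>E\<bar> \<le> (V + 0) / 4 * I"
    by (rule tendsto_lowerbound) simp
  also have "\<dots> \<le> V / 4 * ((y - x) * (1 - (y - x)) * 2 / 6 ^ k)"
    using I total_variation_nonneg[of g] V by (intro mult_mono) (auto simp: zero_ereal_def I0)
  finally show ?thesis by (simp add: field_simps)
qed

section \<open>Distribution of the fractional part\<close>

text \<open>Cut the line into cells \<open>{z..<z + 1}\<close>. In each of them the event is an
  interval starting at \<open>z\<close>, and continuity of the distribution function excludes atoms,
  so end points do not affect its measure. The windows then exhaust the line.\<close>

lemma tendsto_measure_fractional_part_le:
  assumes "real_distribution D" and cont: "\<And>x. isCont (cdf D) x" and s: "0 \<le> s" "s \<le> 1"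
  shows "(\<lambda>N. \<Sum>i<2 * N. cdf D (real i - real N + s) - cdf D (real i - real N))
    \<longlonglongrightarrow> measure D {t. t - of_int \<lfloor>t\<rfloor> \<le> s}"
proof -
  interpret real_distribution D by fact
  define B where "B = {t::real. t - of_int \<lfloor>t\<rfloor> \<le> s}"
  have "(\<lambda>t::real. t - of_int \<lfloor>t\<rfloor>) \<in> borel_measurable borel" by measurable
  then have B[measurable]: "B \<in> sets borel" unfolding B_def by measurable
  have null: "AE t in D. t \<noteq> x" for x
  proof -
    have "measure D {x} = 0" using cont isCont_cdf by auto
    then have "{x} \<in> null_sets D" by (intro null_setsI) (auto simp: emeasure_eq_measure)
    then show ?thesis by (rule AE_I') auto
  qed
  have piece: "measure D (B \<inter> {of_int z..<of_int z + 1}) = cdf D (of_int z + s) - cdf D (of_int z)"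
    for z :: int
  proof (cases "s = 0")
    case True
    have "AE t in D. t \<in> B \<inter> {of_int z..<of_int z + 1} \<longleftrightarrow> t \<in> {}"
      using null[of "of_int z"]
    proof eventually_elim
      case (elim t)
      have "t = of_int z" if "t \<in> B" "of_int z \<le> t" "t < of_int z + 1"
      proof -
        have "\<lfloor>t\<rfloor> = z" using that by (intro floor_unique) auto
        then show ?thesis using that True by (auto simp: B_def)
      qed
      then show ?case using elim by auto
    qed
    then have "measure D (B \<inter> {of_int z..<of_int z + 1}) = measure D {}"
      by (intro measure_eq_AE) auto
    then show ?thesis using True by simp
  next
    case False
    \<comment> \<open>The point \<open>z + 1\<close> makes a difference only for
      \<open>s = 1\<close>, where the half-open interval on the right contains it and the cell does
      not.\<close>
    have "AE t in D. t \<in> B \<inter> {of_int z..<of_int z + 1} \<longleftrightarrow> t \<in> {of_int z<..of_int z + s}"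
      using null[of "of_int z"] null[of "of_int z + 1"]
    proof eventually_elim
      case (elim t)
      have "t \<in> B \<longleftrightarrow> t \<le> of_int z + s" if "of_int z \<le> t" "t < of_int z + 1"
      proof -
        have "\<lfloor>t\<rfloor> = z" using that by (intro floor_unique) auto
        then show ?thesis by (auto simp: B_def)
      qed
      then show ?case using elim s by force
    qed
    then have "measure D (B \<inter> {of_int z..<of_int z + 1}) = measure D {of_int z<..of_int z + s}"
      by (intro measure_eq_AE) auto
    also have "\<dots> = cdf D (of_int z + s) - cdf D (of_int z)"
      using False s by (subst cdf_diff_eq) auto
    finally show ?thesis .
  qed
  have window: "measure D (B \<inter> {- real N..<real n - real N})
      = (\<Sum>i<n. cdf D (real i - real N + s) - cdf D (real i - real N))" for n N :: nat
  proof (induction n)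
    case (Suc n)
    have "B \<inter> {- real N..<real (Suc n) - real N} = (B \<inter> {- real N..<real n - real N})
        \<union> (B \<inter> {of_int (int n - int N)..<of_int (int n - int N) + 1})" by auto
    then have "measure D (B \<inter> {- real N..<real (Suc n) - real N}) = measure D (B \<inter> {- real N..<real n - real N})
        + measure D (B \<inter> {of_int (int n - int N)..<of_int (int n - int N) + 1})"
      by (simp only:) (intro finite_measure_Union; auto)
    then show ?case using Suc piece[of "int n - int N"] by simp
  qed simp
  have "(\<lambda>N. measure D (B \<inter> {- real N..<real N})) \<longlonglongrightarrow> measure D (\<Union>N. B \<inter> {- real N..<real N})"
    by (rule finite_Lim_measure_incseq) (auto simp: incseq_def)
  moreover have "(\<Union>N. B \<inter> {- real N..<real N}) = B"
  proof -
    have "\<exists>N. - real N \<le> t \<and> t < real N" for t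
    proof -
      obtain N where "\<bar>t\<bar> < real N" using reals_Archimedean2 by blast
      then show ?thesis by (intro exI[of _ N]) auto
    qed
    then show ?thesis by auto
  qed
  moreover have "measure D (B \<inter> {- real N..<real N})
      = (\<Sum>i<2 * N. cdf D (real i - real N + s) - cdf D (real i - real N))" for N :: nat
    using window[of N "2 * N"] by simp
  ultimately show ?thesis by (simp add: B_def)
qed

lemma distributed_cdf_has_real_derivative:
  fixes f :: "real \<Rightarrow> real"
  assumes "prob_space M" and dist: "distributed M lborel Y (\<lambda>x. ennreal (f x))"
    and f0: "\<And>x. 0 \<le> f x" and cont: "continuous_on UNIV f"
  shows "(cdf (distr M borel Y) has_real_derivative f x) (at x)"
proof -
  interpret prob_space M by fact
  have Y[measurable]: "Y \<in> borel_measurable M" using distributed_measurable[OF dist] by simp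
  interpret D: real_distribution "distr M borel Y" by (rule real_distribution_distr) simp
  let ?F = "cdf (distr M borel Y)"
  \<comment> \<open>Starting at \<open>x - 2\<close> puts all of \<open>{x - 1..x + 1}\<close> in
    the interior of \<open>{x - 2..x + 2}\<close>, so the derivative of \<open>\<Phi>\<close> there
    is two-sided.\<close>
  define \<Phi> where "\<Phi> t = integral {x - 2..t} f" for t
  have f[measurable]: "f \<in> borel_measurable borel" using cont by (rule borel_measurable_continuous_onI)
  have \<Phi>: "(\<Phi> has_real_derivative f t) (at t)" if "x - 1 \<le> t" "t \<le> x + 1" for t
  proof -
    have "(\<Phi> has_real_derivative f t) (at t within {x - 2..x + 2})"
      unfolding \<Phi>_def [abs_def] using that
      by (intro integral_has_real_derivative continuous_on_subset[OF cont]) auto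
    moreover have "at t within {x - 2..x + 2} = at t"
      using that by (intro at_within_interior) simp
    ultimately show ?thesis by (simp only:)
  qed
  have eq: "?F t = ?F (x - 1) + \<Phi> t - \<Phi> (x - 1)" if t: "t \<in> {x - 1<..<x + 1}" for t
  proof -
    have "emeasure (distr M borel Y) {x - 1<..t} = emeasure M (Y -` {x - 1<..t} \<inter> space M)"
      by (rule emeasure_distr) simp_all
    also have "\<dots> = (\<integral>\<^sup>+s. ennreal (f s) * indicator {x - 1<..t} s \<partial>lborel)"
      by (rule distributed_emeasure[OF dist]) simp
    also have "\<dots> = (\<integral>\<^sup>+s. ennreal (f s) * indicator {x - 1..t} s \<partial>lborel)"
    proof (rule nn_integral_cong_AE)
      show "AE s in lborel. ennreal (f s) * indicator {x - 1<..t} s = ennreal (f s) * indicator {x - 1..t} s"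
        using AE_lborel_singleton[of "x - 1"]
      proof eventually_elim
        case (elim s)
        then show ?case by (cases "s \<in> {x - 1..t}") auto
      qed
    qed
    also have "\<dots> = ennreal (\<Phi> t - \<Phi> (x - 1))"
    proof (rule nn_integral_FTC_Icc[where F = \<Phi>, OF f])
      show "(\<Phi> has_real_derivative f s) (at s)" if "s \<in> {x - 1..t}" for s
        using t that by (intro \<Phi>) auto
    qed (use f0 t in auto)
    finally have "ennreal (measure (distr M borel Y) {x - 1<..t}) = ennreal (\<Phi> t - \<Phi> (x - 1))"
      by (simp add: D.emeasure_eq_measure)
    moreover have "\<Phi> (x - 1) \<le> \<Phi> t"
    proof (rule DERIV_nonneg_imp_nondecreasing[where f = \<Phi>])
      fix s assume "x - 1 \<le> s" "s \<le> t"
      then have "(\<Phi> has_real_derivative f s) (at s)" using t by (intro \<Phi>) auto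
      then show "\<exists>y. (\<Phi> has_real_derivative y) (at s) \<and> 0 \<le> y" using f0 by blast
    qed (use t in auto)
    ultimately have "measure (distr M borel Y) {x - 1<..t} = \<Phi> t - \<Phi> (x - 1)" by simp
    moreover have "?F t - ?F (x - 1) = measure (distr M borel Y) {x - 1<..t}"
      using t by (intro D.cdf_diff_eq) simp
    ultimately show ?thesis by simp
  qed
  have "((\<lambda>t. ?F (x - 1) + \<Phi> t - \<Phi> (x - 1)) has_real_derivative f x) (at x)"
    using DERIV_diff[OF DERIV_add[OF DERIV_const \<Phi>[of x]] DERIV_const] by simp
  then show ?thesis
  proof (rule has_field_derivative_transform_within_open)
    show "open {x - 1<..<x + 1}" "x \<in> {x - 1<..<x + 1}" by simp_all
  qed (rule eq[symmetric])
qed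

theorem corollary4:
  fixes M :: "'a measure" and Y :: "'a \<Rightarrow> real"
    and f g G :: "real \<Rightarrow> real" and k :: nat
  assumes "prob_space M"
    and "distributed M lborel Y (\<lambda>x. ennreal (f x))"
    and "\<And>x. 0 \<le> f x"
    and "\<And>x. 0 \<le> x \<Longrightarrow> x \<le> 1 \<Longrightarrow>
      G x = measure M {\<omega> \<in> space M. Y \<omega> - of_int \<lfloor>Y \<omega>\<rfloor> \<le> x}"
    and "1 \<le> k"
    and "times_absolutely_continuous k f"
    and "version_of_deriv k f g"
    and "total_variation g < \<infinity>"
  shows "(\<forall>x y. 0 \<le> x \<and> x < y \<and> y \<le> 1 \<longrightarrow>
        ereal \<bar>G y - G x - (y - x)\<bar>
          \<le> ereal ((y - x) * (1 - (y - x))) * (total_variation g / (2 * 6 ^ k)))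
    \<and> KD G \<le> total_variation g / (8 * 6 ^ k)
    \<and> MRAE G \<le> total_variation g / (2 * 6 ^ k)"
proof -
  interpret prob_space M by fact
  have Y[measurable]: "Y \<in> borel_measurable M" using distributed_measurable[OF assms(2)] by simp
  let ?D = "distr M borel Y"
  let ?F = "cdf ?D"
  interpret D: real_distribution ?D by (rule real_distribution_distr) simp
  obtain V where V: "total_variation g = ereal V" "0 \<le> V"
    using assms(8) total_variation_nonneg[of g] by (cases "total_variation g") auto
  have "continuous_on UNIV f"
  proof (cases "k = 1")
    case True
    then show ?thesis using assms(6)
      by (simp add: times_absolutely_continuous_def continuously_differentiable_def)
  next
    case False
    then have "0 < k - 1" using assms(5) by simp
    then have "(deriv ^^ 0) f differentiable_on UNIV"
      using assms(6) unfolding times_absolutely_continuous_def continuously_differentiable_def by blast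
    then show ?thesis by (simp add: differentiable_imp_continuous_on)
  qed
  then have F: "(?F has_real_derivative f x) (at x)" for x
    by (rule distributed_cdf_has_real_derivative[OF assms(1-3)])
  have Glim: "(\<lambda>N. \<Sum>i<2 * N. ?F (real i - real N + s) - ?F (real i - real N)) \<longlonglongrightarrow> G s"
    if "0 \<le> s" "s \<le> 1" for s
  proof -
    have "(\<lambda>t::real. t - of_int \<lfloor>t\<rfloor>) \<in> borel_measurable borel" by measurable
    then have "{t::real. t - of_int \<lfloor>t\<rfloor> \<le> s} \<in> sets borel" by measurable
    then have "measure ?D {t. t - of_int \<lfloor>t\<rfloor> \<le> s} = G s"
      unfolding assms(4)[OF that] by (subst measure_distr) (auto intro!: arg_cong[of _ _ "measure M"])
    then show ?thesis
      using tendsto_measure_fractional_part_le[OF D.real_distribution_axioms DERIV_isCont[OF F] that] by simp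
  qed
  have "t - of_int \<lfloor>t\<rfloor> \<le> 1" for t :: real by linarith
  then have G1: "G 1 = 1" using assms(4)[of 1] by (simp add: prob_space)
  have main: "\<bar>G y - G x - (y - x)\<bar> \<le> (y - x) * (1 - (y - x)) * (V / (2 * 6 ^ k))"
    if xy: "0 \<le> x" "x < y" "y \<le> 1" for x y
  proof (rule periodized_increment_bound[OF F D.cdf_lim_at_top_prob D.cdf_lim_at_bot assms(5-7) V(1) xy])
    \<comment> \<open>Writing \<open>y - x\<close> as \<open>(y - x) * G 1\<close> makes it a limit
      of sums over unit cells too, and the three sums merge into the one required.\<close>
    have "(\<lambda>N. (\<Sum>i<2 * N. ?F (real i - real N + y) - ?F (real i - real N))
        - (\<Sum>i<2 * N. ?F (real i - real N + x) - ?F (real i - real N))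
        - (y - x) * (\<Sum>i<2 * N. ?F (real i - real N + 1) - ?F (real i - real N)))
      \<longlonglongrightarrow> G y - G x - (y - x) * G 1"
      using xy by (intro tendsto_intros Glim) auto
    then show "(\<lambda>N. \<Sum>i<2 * N. ?F (real i - real N + y) - ?F (real i - real N + x)
        - (y - x) * (?F (real i - real N + 1) - ?F (real i - real N))) \<longlonglongrightarrow> G y - G x - (y - x)"
      by (simp add: G1 sum_subtractf flip: sum_distrib_left)
  qed
  have scale: "total_variation g / (c * 6 ^ k) = ereal (V / (c' * 6 ^ k))" if "c = ereal c'" "0 < c'" for c c'
  proof -
    have "c * 6 ^ k = ereal (c' * 6 ^ k)"
      using that by (metis ereal_power numeral_eq_ereal times_ereal.simps(1))
    then show ?thesis using that V by simp
  qed
  have scale2: "total_variation g / (2 * 6 ^ k) = ereal (V / (2 * 6 ^ k))"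
    and scale8: "total_variation g / (8 * 6 ^ k) = ereal (V / (8 * 6 ^ k))"
    by (rule scale[OF numeral_eq_ereal]; simp)+
  define W where "W = V / (2 * 6 ^ k)"
  have W: "0 \<le> W" using V by (simp add: W_def)
  show ?thesis
  proof (intro conjI allI impI)
    fix x y :: real assume "0 \<le> x \<and> x < y \<and> y \<le> 1"
    then show "ereal \<bar>G y - G x - (y - x)\<bar>
        \<le> ereal ((y - x) * (1 - (y - x))) * (total_variation g / (2 * 6 ^ k))"
      unfolding scale2 using main[of x y] by simp
  next
    have "\<bar>G y - G x - (y - x)\<bar> \<le> V / (8 * 6 ^ k)" if "0 \<le> x" "x < y" "y \<le> 1" for x y
    proof -
      have "(y - x) * (1 - (y - x)) \<le> 1 / 4"
        using zero_le_power2[of "y - x - 1 / 2"] by (simp add: power2_eq_square algebra_simps)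
      then have "(y - x) * (1 - (y - x)) * W \<le> 1 / 4 * W" using W by (rule mult_right_mono)
      then show ?thesis using main[OF that] by (simp add: W_def)
    qed
    then show "KD G \<le> total_variation g / (8 * 6 ^ k)"
      unfolding KD_def scale8 by (intro SUP_least) auto
  next
    have "\<bar>(G y - G x) / (y - x) - 1\<bar> \<le> V / (2 * 6 ^ k)" if xy: "0 \<le> x" "x < y" "y \<le> 1" for x y
    proof -
      have "(G y - G x) / (y - x) - 1 = (G y - G x - (y - x)) / (y - x)"
        using xy by (simp add: diff_divide_distrib)
      then have "\<bar>(G y - G x) / (y - x) - 1\<bar> = \<bar>G y - G x - (y - x)\<bar> / (y - x)"
        using xy by simp
      also have "\<dots> \<le> (y - x) * (1 - (y - x)) * W / (y - x)"
        using main[OF xy] xy by (intro divide_right_mono) (auto simp: W_def)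
      also have "\<dots> = (1 - (y - x)) * W" using xy by simp
      also have "\<dots> \<le> 1 * W" using xy W by (intro mult_right_mono) auto
      finally show ?thesis by (simp add: W_def)
    qed
    then show "MRAE G \<le> total_variation g / (2 * 6 ^ k)"
      unfolding MRAE_def scale2 by (intro SUP_least) auto
  qed
qed

end
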